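(* Given $G^2$ and $M>0$, let $\mu$ be fixed such that $$M\mu\,\|F_\mu^{-1}\|=\mathrm{tr}(F_\mu^{-1}).$$ Let also $$\mathrm{tr}\bigl(F_\mu^{-1}/\|F_\mu^{-1}\|\bigr)\le C\,\mathrm{tr}\bigl(F_\mu^{-2}/\|F_\mu^{-2}\|\bigr)$$ with a fixed constant $C$. Then, with $C_1>0$ and $C_2>0$ depending on $C$ only, $$\inf_{\hat f}\ \sup_{f^*\in\mathcal F_G(M)}P\Bigl(\|\hat f-f^*\|^2>C_1\,\mathrm{tr}(F_\mu^{-1})\Bigr)\ge1-e^{-C_2M\mu},$$ where the infimum is over all estimators $\hat f=\hat f(Y)$ of $f^*$.
   Context: Linear Gaussian inverse problem: $Y=Af^*+\sigma\varepsilon$, where $A:\mathcal X^d\to\mathcal Y^d$ is a linear operator between Euclidean spaces, $\sigma>0$ and $\varepsilon$ is standard Gaussian noise ($\mathrm{Var}(\varepsilon)=I$); $P$ is the law of $Y$ under the true $f^*$. $G^2$ is a symmetric positive operator on $\mathcal X^d$, $\mathcal F_G(M)=\{f:\|Gf\|^2\le M\}$; $F=\sigma^{-2}A^\top A$ and $F_\mu=F+\mu G^2$ for $\mu\ge1$. Norms of matrices are operator norms. *)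

theory Defs
  imports "HOL-Probability.Probability" "Jordan_Normal_Form.Determinant"
begin

text \<open>
  The constants in the theorem may not depend on the dimensions, so the dimensions must be
  quantified inside the formula.  Euclidean spaces are therefore the carriers
  \<^term>\<open>carrier_vec n\<close> of real vectors of length \<^term>\<open>n\<close>, and linear operators are real matrices.
\<close>

definition vec_norm2 :: "real Matrix.vec \<Rightarrow> real" where
  "vec_norm2 v = sqrt (scalar_prod v v)"

definition mat_trace :: "real mat \<Rightarrow> real" where
  "mat_trace B = (\<Sum>i<dim_row B. B $$ (i, i))"

definition op_norm :: "real mat \<Rightarrow> real" where
  "op_norm B = (SUP v\<in>{v \<in> carrier_vec (dim_col B). vec_norm2 v \<le> 1}. vec_norm2 (B *\<^sub>v v))"

text \<open>
  Positive means positive semidefinite; the invertibility of \<open>F + \<mu> G\<^sup>2\<close>, automatic when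
  \<open>G\<^sup>2\<close> is positive definite (see \<open>Fisher_pen_invertible\<close> below), is assumed separately
  in the theorem.
\<close>

definition sym_positive_mat :: "nat \<Rightarrow> real mat \<Rightarrow> bool" where
  "sym_positive_mat n B \<longleftrightarrow>
     B \<in> carrier_mat n n \<and> transpose_mat B = B \<and>
     (\<forall>v\<in>carrier_vec n. 0 \<le> scalar_prod v (B *\<^sub>v v))"

definition Fisher :: "real mat \<Rightarrow> real \<Rightarrow> real mat" where
  "Fisher A \<sigma> = (1 / \<sigma>\<^sup>2) \<cdot>\<^sub>m (transpose_mat A * A)"

definition Fisher_pen :: "real mat \<Rightarrow> real \<Rightarrow> real mat \<Rightarrow> real \<Rightarrow> real mat" where
  "Fisher_pen A \<sigma> G2 \<mu> = Fisher A \<sigma> + \<mu> \<cdot>\<^sub>m G2"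

definition ellipsoid :: "real mat \<Rightarrow> real \<Rightarrow> real Matrix.vec set" where
  "ellipsoid G M = {f \<in> carrier_vec (dim_col G). (vec_norm2 (G *\<^sub>v f))\<^sup>2 \<le> M}"

text \<open>The Borel sigma-algebra on vectors of length \<open>n\<close>, transported from the \<open>n\<close>-fold product.\<close>

definition vec_borel :: "nat \<Rightarrow> real Matrix.vec measure" where
  "vec_borel n = vimage_algebra (carrier_vec n) (\<lambda>v. \<lambda>i\<in>{..<n}. vec_index v i)
                   (\<Pi>\<^sub>M i\<in>{..<n}. (borel :: real measure))"

definition std_gaussian :: "nat \<Rightarrow> real Matrix.vec measure" where
  "std_gaussian n = distr (\<Pi>\<^sub>M i\<in>{..<n}. std_normal_distribution)
                      (vec_borel n) (Matrix.vec n)"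

text \<open>The law of \<open>Y = A f + \<sigma> \<epsilon>\<close> with \<open>\<epsilon>\<close> standard Gaussian.\<close>

definition obs_law :: "real mat \<Rightarrow> real \<Rightarrow> real Matrix.vec \<Rightarrow> real Matrix.vec measure" where
  "obs_law A \<sigma> f = distr (std_gaussian (dim_row A)) (vec_borel (dim_row A))
                     (\<lambda>e. A *\<^sub>v f + \<sigma> \<cdot>\<^sub>v e)"

definition estimators :: "nat \<Rightarrow> nat \<Rightarrow> (real Matrix.vec \<Rightarrow> real Matrix.vec) set" where
  "estimators m n = measurable (vec_borel m) (vec_borel n)"


lemma space_vec_borel [simp]: "space (vec_borel n) = carrier_vec n"
  by (simp add: vec_borel_def)

lemma measurable_vec_index:
  assumes "i < n"
  shows "(\<lambda>v. vec_index v i) \<in> borel_measurable (vec_borel n)"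
proof -
  have "(\<lambda>v. \<lambda>j\<in>{..<n}. vec_index v j) \<in> measurable (vec_borel n) (\<Pi>\<^sub>M i\<in>{..<n}. (borel :: real measure))"
    unfolding vec_borel_def
    by (rule measurable_vimage_algebra1) (intro funcsetI, simp only: space_PiM space_borel restrict_PiE_iff, simp)
  from measurable_compose[OF this measurable_component_singleton[of i "{..<n}"]] assms
  show ?thesis by simp
qed

lemma measurable_vec_borelI:
  assumes "\<And>x. x \<in> space N \<Longrightarrow> g x \<in> carrier_vec n"
    and "\<And>i. i < n \<Longrightarrow> (\<lambda>x. vec_index (g x) i) \<in> borel_measurable N"
  shows "g \<in> measurable N (vec_borel n)"
  unfolding vec_borel_def
proof (rule measurable_vimage_algebra2)
  show "(\<lambda>x. \<lambda>i\<in>{..<n}. vec_index (g x) i) \<in> measurable N (\<Pi>\<^sub>M i\<in>{..<n}. (borel :: real measure))"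
    by (rule measurable_restrict) (rule assms(2), simp)
qed (rule funcsetI, rule assms(1))

lemma prob_space_std_gaussian: "prob_space (std_gaussian n)"
  unfolding std_gaussian_def
proof (rule prob_space.prob_space_distr)
  interpret normal: prob_space std_normal_distribution
    by (rule real_distribution.axioms(1)[OF real_dist_normal_dist])
  show "prob_space (\<Pi>\<^sub>M i\<in>{..<n}. std_normal_distribution)"
    by (rule prob_space_PiM) (rule normal.prob_space_axioms)
  show "Matrix.vec n \<in> measurable (\<Pi>\<^sub>M i\<in>{..<n}. std_normal_distribution)
     (vec_borel n)"
  proof (rule measurable_vec_borelI)
    fix i assume i: "i < n"
    have "(\<lambda>x. x i) \<in> measurable (\<Pi>\<^sub>M i\<in>{..<n}. std_normal_distribution)
            std_normal_distribution"
      by (rule measurable_component_singleton) (use i in auto)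
    then show "(\<lambda>x. vec_index (Matrix.vec n x) i) \<in> borel_measurable
        (\<Pi>\<^sub>M i\<in>{..<n}. std_normal_distribution)"
      using i by simp
  qed (rule vec_carrier)
qed

lemma space_std_gaussian [simp]: "space (std_gaussian n) = carrier_vec n"
  and sets_std_gaussian: "sets (std_gaussian n) = sets (vec_borel n)"
  by (simp_all add: std_gaussian_def)

lemma space_obs_law [simp]: "space (obs_law A \<sigma> f) = carrier_vec (dim_row A)"
  and sets_obs_law: "sets (obs_law A \<sigma> f) = sets (vec_borel (dim_row A))"
  by (simp_all add: obs_law_def)

lemma prob_space_obs_law: "prob_space (obs_law A \<sigma> f)"
  unfolding obs_law_def
proof (rule prob_space.prob_space_distr[OF prob_space_std_gaussian], rule measurable_vec_borelI)
  fix i assume i: "i < dim_row A"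
  have "(\<lambda>e. vec_index e i) \<in> borel_measurable (std_gaussian (dim_row A))"
    by (subst measurable_cong_sets[OF sets_std_gaussian refl]) (rule measurable_vec_index[OF i])
  then have meas: "(\<lambda>e. vec_index (A *\<^sub>v f) i + \<sigma> * vec_index e i)
          \<in> borel_measurable (std_gaussian (dim_row A))"
    by (intro borel_measurable_add borel_measurable_times borel_measurable_const)
  have eq: "vec_index (A *\<^sub>v f + \<sigma> \<cdot>\<^sub>v e) i = vec_index (A *\<^sub>v f) i + \<sigma> * vec_index e i"
    if "e \<in> space (std_gaussian (dim_row A))" for e
    using that i by simp
  show "(\<lambda>e. vec_index (A *\<^sub>v f + \<sigma> \<cdot>\<^sub>v e) i)
          \<in> borel_measurable (std_gaussian (dim_row A))"
    by (rule measurable_cong[OF eq, THEN iffD2, OF _ meas])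
qed (rule carrier_vecI, simp only: space_std_gaussian index_add_vec(2) index_smult_vec(2) carrier_vecD)

lemma Fisher_pen_invertible:
  assumes A: "A \<in> carrier_mat m n" and G2: "G2 \<in> carrier_mat n n" and \<mu>: "\<mu> > 0"
    and pos: "\<And>v. v \<in> carrier_vec n \<Longrightarrow> v \<noteq> 0\<^sub>v n \<Longrightarrow> 0 < scalar_prod v (G2 *\<^sub>v v)"
  shows "invertible_mat (Fisher_pen A \<sigma> G2 \<mu>)"
proof -
  let ?F = "Fisher_pen A \<sigma> G2 \<mu>"
  have F: "?F \<in> carrier_mat n n"
    using A G2 by (auto simp: Fisher_pen_def Fisher_def)
  have smult: "(c \<cdot>\<^sub>m B) *\<^sub>v v = c \<cdot>\<^sub>v (B *\<^sub>v v)"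
    if "B \<in> carrier_mat n n" "v \<in> carrier_vec n" for c :: real and B v
    using that by (intro eq_vecI) (auto simp: scalar_prod_def sum_distrib_left mult_ac)
  have "det ?F \<noteq> 0"
  proof
    assume "det ?F = 0"
    then obtain v where v: "v \<in> carrier_vec n" "v \<noteq> 0\<^sub>v n" "?F *\<^sub>v v = 0\<^sub>v n"
      using det_0_iff_vec_prod_zero_field[OF F] by auto
    have smult_closed: "c \<cdot>\<^sub>v w \<in> carrier_vec n" if "w \<in> carrier_vec n" for c :: real and w
      using that by simp
    have Av: "A *\<^sub>v v \<in> carrier_vec m" using A v by auto
    have At: "transpose_mat A \<in> carrier_mat n m" using A by auto
    have AtA: "transpose_mat A * A \<in> carrier_mat n n" using A by auto
    have "scalar_prod v ((transpose_mat A * A) *\<^sub>v v) = scalar_prod v (transpose_mat A *\<^sub>v (A *\<^sub>v v))"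
      by (simp only: assoc_mult_mat_vec[OF At A v(1)])
    also have "\<dots> = scalar_prod (transpose_mat A *\<^sub>v (A *\<^sub>v v)) v"
      by (rule comm_scalar_prod[OF v(1)]) (use At Av in auto)
    also have "\<dots> = scalar_prod (A *\<^sub>v v) (A *\<^sub>v v)"
      by (rule transpose_vec_mult_scalar[OF A v(1) Av])
    also have "\<dots> \<ge> 0"
      by (auto simp: scalar_prod_def intro!: sum_nonneg)
    finally have nn: "0 \<le> scalar_prod v ((transpose_mat A * A) *\<^sub>v v)" .
    have c1: "(transpose_mat A * A) *\<^sub>v v \<in> carrier_vec n" and c2: "G2 *\<^sub>v v \<in> carrier_vec n"
      using AtA G2 v(1) by auto
    have "?F *\<^sub>v v = (1 / \<sigma>\<^sup>2) \<cdot>\<^sub>v ((transpose_mat A * A) *\<^sub>v v) + \<mu> \<cdot>\<^sub>v (G2 *\<^sub>v v)"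
      unfolding Fisher_pen_def Fisher_def
      using add_mult_distrib_mat_vec[OF smult_carrier_mat[OF AtA] smult_carrier_mat[OF G2] v(1)]
      by (simp only: smult[OF AtA v(1)] smult[OF G2 v(1)])
    then have "scalar_prod v (?F *\<^sub>v v) =
        (1 / \<sigma>\<^sup>2) * scalar_prod v ((transpose_mat A * A) *\<^sub>v v) + \<mu> * scalar_prod v (G2 *\<^sub>v v)"
      by (simp only: scalar_prod_smult_distrib[OF v(1) c1] scalar_prod_smult_distrib[OF v(1) c2]
          scalar_prod_add_distrib[OF v(1) smult_closed[OF c1] smult_closed[OF c2]])
    moreover have "0 < \<mu> * scalar_prod v (G2 *\<^sub>v v)" using \<mu> pos v by simp
    moreover have "0 \<le> (1 / \<sigma>\<^sup>2) * scalar_prod v ((transpose_mat A * A) *\<^sub>v v)"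
      using nn by (intro mult_nonneg_nonneg) auto
    moreover have "scalar_prod v (?F *\<^sub>v v) = 0" unfolding v(3) using v(1) by simp
    ultimately show False by linarith
  qed
  have "?F \<in> Units (ring_mat TYPE(real) n ())"
    by (rule det_non_zero_imp_unit[OF F \<open>det ?F \<noteq> 0\<close>])
  then have "\<exists>B\<in>carrier_mat n n. B * ?F = 1\<^sub>m n \<and> ?F * B = 1\<^sub>m n"
    by (simp only: Units_def mem_Collect_eq ring_mat_simps)
  then obtain B where B: "B \<in> carrier_mat n n" "B * ?F = 1\<^sub>m n" "?F * B = 1\<^sub>m n"
    by (elim bexE conjE)
  have dims: "dim_row ?F = n" "dim_col ?F = n" "dim_row B = n"
    using F B(1) by (simp_all only: carrier_mat_def mem_Collect_eq)
  have "inverts_mat ?F B" "inverts_mat B ?F"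
    by (simp_all only: inverts_mat_def dims B(2,3))
  moreover have "square_mat ?F" by (simp only: square_mat.simps dims)
  ultimately show ?thesis
    unfolding invertible_mat_def by (intro conjI exI)
qed

end

theory Submission
  imports Defs "Jordan_Normal_Form.Char_Poly" "HOL-Computational_Algebra.Fundamental_Theorem_Algebra"
begin

text \<open>
  The bound is a Bayesian one: a supremum over the ellipsoid dominates an average over a prior, so
  it suffices to find a Gaussian prior that almost lives on the ellipsoid and under which no
  estimator comes close to \<open>f\<close> with non-negligible probability.

  Let \<open>\<beta>\<^sub>1, \<dots>, \<beta>\<^sub>n\<close> be the eigenvalues of \<open>B = F\<^sub>\<mu>\<^sup>-\<^sup>1\<close>, let \<open>b\<close> be the largest one and
  \<open>u\<^sub>k = \<beta>\<^sub>k / b\<close>.  The balance condition reads \<open>\<Sum>u\<^sub>k = M \<mu>\<close>, and the trace condition reads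
  \<open>\<Sum>u\<^sub>k \<le> C \<Sum>u\<^sub>k\<^sup>2\<close>.  The prior is \<open>N(0, B\<^sup>2 / (8 b))\<close>, that is, independent coordinates of
  variance \<open>b u\<^sub>k\<^sup>2 / 8\<close> in the eigenbasis.

  The prior stays in the ellipsoid.  Since \<open>\<mu> G\<^sup>2 \<le> F\<^sub>\<mu>\<close>, the quantity \<open>\<mu> \<parallel>G f\<parallel>\<^sup>2\<close> is at most
  \<open>\<Sum>u\<^sub>k \<zeta>\<^sub>k\<^sup>2 / 8\<close> with standard normal \<open>\<zeta>\<^sub>k\<close>; its mean is \<open>M \<mu> / 8\<close>, and a Chernoff bound gives
  probability at most \<open>exp (- 3 M \<mu> / 2)\<close> for exceeding \<open>M \<mu>\<close>
  (\<open>gaussian_weighted_chi_square_tail\<close>).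

  The posterior is spread out.  Its precision is \<open>F + 8 b B\<^sup>-\<^sup>2\<close>, and \<open>F\<close> need not commute with
  \<open>B\<close>.  To make everything diagonal the statistician is given the additional observation
  \<open>Z = \<mu>\<^sup>1\<^sup>/\<^sup>2 G f + \<xi>\<close> with fresh noise, which an estimator may ignore: the Fisher information of the
  pair \<open>(Y, Z)\<close> is \<open>F + \<mu> G\<^sup>2 = B\<^sup>-\<^sup>1\<close>.  In the eigenbasis the posterior is then a product of
  one-dimensional Gaussians, and the posterior Laplace transform of the squared loss is bounded,
  for every guess, by that of the guess at the posterior mean
  (\<open>gaussian_posterior_small_ball\<close>).  Markov's inequality for this transform, with a
  parameter of order \<open>exp (5 C) / b\<close>, shows that the loss is below a small multiple of
  \<open>tr B = b \<Sum>u\<^sub>k\<close> with probability at most \<open>exp (- 3 M \<mu> / 2)\<close>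
  (\<open>gaussian_bayes_small_ball_probability\<close>); this is where the trace condition enters.

  The two exceptional probabilities add up to \<open>2 exp (- 3 M \<mu> / 2)\<close>.  Because the largest \<open>u\<^sub>k\<close> is
  \<open>1\<close>, one has \<open>M \<mu> \<ge> 1\<close>, and the factor \<open>2\<close> is absorbed into the exponent.

  Everything is expressed in coordinates over products of one-dimensional measures, so that only
  Fubini's theorem and translations on the line are needed.
\<close>

section \<open>The spectral theorem for real symmetric matrices\<close>

text \<open>
  A complex root \<open>z\<close> of the characteristic polynomial exists, with an eigenvector \<open>w\<close>.  The form
  \<open>w\<^sup>* A w = z \<parallel>w\<parallel>\<^sup>2\<close> equals its own conjugate by symmetry of \<open>A\<close>, so \<open>z\<close> is real and hence a root of
  the real characteristic polynomial.
\<close>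
lemma symmetric_mat_real_eigenvalue:
  fixes A :: "real mat"
  assumes A: "A \<in> carrier_mat n n" and sym: "transpose_mat A = A" and n: "0 < n"
  shows "\<exists>e. eigenvalue A e"
proof -
  let ?A = "map_mat complex_of_real A"
  have A': "?A \<in> carrier_mat n n" using A by auto
  have sym_entry: "A $$ (i, j) = A $$ (j, i)" if "i < n" "j < n" for i j
    using arg_cong[OF sym, of "\<lambda>B. B $$ (i, j)"] A that by auto
  have "degree (char_poly ?A) \<noteq> 0" using degree_monic_char_poly[OF A'] n by simp
  then have "\<not> constant (poly (char_poly ?A))" by (simp add: constant_degree)
  then obtain z where z: "poly (char_poly ?A) z = 0"
    using fundamental_theorem_of_algebra by blast
  then have "eigenvalue ?A z" using eigenvalue_root_char_poly[OF A'] by simp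
  then obtain v where v: "v \<in> carrier_vec n" "v \<noteq> 0\<^sub>v n" "?A *\<^sub>v v = z \<cdot>\<^sub>v v"
    using A' by (auto simp: eigenvalue_def eigenvector_def)
  define w where "w = (\<lambda>i. vec_index v i)"
  have eig: "(\<Sum>j<n. complex_of_real (A $$ (i, j)) * w j) = z * w i" if "i < n" for i
    using arg_cong[OF v(3), of "\<lambda>x. vec_index x i"] v(1) A that
    by (auto simp: scalar_prod_def w_def lessThan_atLeast0)
  define q where "q = (\<Sum>i<n. \<Sum>j<n. cnj (w i) * complex_of_real (A $$ (i, j)) * w j)"
  define N where "N = (\<Sum>i<n. (cmod (w i))\<^sup>2)"
  have "q = (\<Sum>i<n. cnj (w i) * (z * w i))"
    unfolding q_def by (intro sum.cong refl) (simp add: eig[symmetric] sum_distrib_left mult_ac)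
  also have "\<dots> = z * complex_of_real N"
    unfolding N_def of_real_sum sum_distrib_left
    by (intro sum.cong refl) (simp only: complex_norm_square, simp add: mult_ac)
  finally have qN: "q = z * complex_of_real N" .
  have "cnj q = (\<Sum>i<n. \<Sum>j<n. w i * complex_of_real (A $$ (i, j)) * cnj (w j))"
    by (simp add: q_def)
  also have "\<dots> = (\<Sum>j<n. \<Sum>i<n. w i * complex_of_real (A $$ (i, j)) * cnj (w j))"
    by (rule sum.swap)
  also have "\<dots> = q"
    unfolding q_def by (intro sum.cong refl) (simp add: sym_entry mult_ac)
  finally have "cnj z * complex_of_real N = z * complex_of_real N" using qN by simp
  moreover have "N \<noteq> 0"
  proof
    assume "N = 0"
    then have "\<forall>i\<in>{..<n}. (cmod (w i))\<^sup>2 = 0"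
      unfolding N_def by (subst (asm) sum_nonneg_eq_0_iff) auto
    then have "v = 0\<^sub>v n" using v(1) by (intro eq_vecI) (auto simp: w_def)
    with v(2) show False by simp
  qed
  ultimately have "cnj z = z" by simp
  then have "z = complex_of_real (Re z)" by (metis Reals_cnj_iff complex_is_Real_iff of_real_Re)
  with z have "poly (map_poly complex_of_real (char_poly A)) (complex_of_real (Re z)) = 0"
    using of_real_hom.char_poly_hom[OF A, where 'a=complex] by simp
  then have "poly (char_poly A) (Re z) = 0" by simp
  then show ?thesis using eigenvalue_root_char_poly[OF A] by blast
qed

text \<open>
  The reflection in the hyperplane orthogonal to \<open>v - e\<^sub>0\<close> exchanges \<open>v\<close> and the first basis vector
  \<open>e\<^sub>0\<close>.  It serves to complete a unit vector to an orthonormal basis.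
\<close>
lemma householder:
  fixes v :: "nat \<Rightarrow> real"
  assumes n: "0 < n" and unit: "(\<Sum>i<n. (v i)\<^sup>2) = 1"
  shows "\<exists>H. H \<in> carrier_mat n n \<and> transpose_mat H = H \<and> H * H = 1\<^sub>m n \<and> (\<forall>i<n. H $$ (i, 0) = v i)"
proof (cases "\<forall>i<n. v i = (if i = 0 then 1 else 0)")
  case True
  then show ?thesis using n by (intro exI[of _ "1\<^sub>m n"]) auto
next
  case False
  define w where "w i = v i - (if i = 0 then 1 else 0)" for i
  define s where "s = (\<Sum>i<n. (w i)\<^sup>2)"
  obtain k where k: "k < n" "w k \<noteq> 0" using False by (auto simp: w_def)
  have "s = (\<Sum>i<n. (v i)\<^sup>2 + (if i = 0 then 1 - 2 * v i else 0))"
    unfolding s_def by (intro sum.cong refl) (simp add: w_def power2_eq_square algebra_simps)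
  then have s: "s = 2 - 2 * v 0"
    using n by (simp add: sum.distrib unit)
  have "0 < (w k)\<^sup>2" using k by simp
  also have "\<dots> \<le> s" unfolding s_def by (rule member_le_sum) (use k in auto)
  finally have s_pos: "0 < s" .
  define H where "H = Matrix.mat n n (\<lambda>(i, j). (if i = j then 1 else 0) - 2 * w i * w j / s)"
  have H: "H \<in> carrier_mat n n" by (simp add: H_def)
  have "transpose_mat H = H" by (rule eq_matI) (auto simp: H_def)
  moreover have "H * H = 1\<^sub>m n"
  proof (rule eq_matI)
    fix i j assume "i < dim_row (1\<^sub>m n :: real mat)" "j < dim_col (1\<^sub>m n :: real mat)"
    then have ij: "i < n" "j < n" by auto
    have "(H * H) $$ (i, j) = (\<Sum>l<n. ((if i = l then 1 else 0) - 2 * w i * w l / s) *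
        ((if l = j then 1 else 0) - 2 * w l * w j / s))"
      using ij by (simp add: H_def scalar_prod_def lessThan_atLeast0)
    also have "\<dots> = (\<Sum>l<n. (if i = l then (if l = j then 1 else 0) - 2 * w l * w j / s else 0)
        + (if l = j then - 2 * w i * w l / s else 0) + 4 * w i * w j / s\<^sup>2 * (w l)\<^sup>2)"
      by (intro sum.cong refl) (auto simp: power2_eq_square algebra_simps)
    also have "\<dots> = (if i = j then 1 else 0) - 2 * w i * w j / s - 2 * w i * w j / s + 4 * w i * w j / s\<^sup>2 * s"
      using ij by (simp add: sum.distrib s_def sum_distrib_left)
    also have "\<dots> = (if i = j then 1 else 0)"
      using s_pos by (simp add: power2_eq_square)
    finally show "(H * H) $$ (i, j) = 1\<^sub>m n $$ (i, j)" using ij by simp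
  qed (use H in auto)
  moreover have "\<forall>i<n. H $$ (i, 0) = v i"
  proof (intro allI impI)
    fix i assume i: "i < n"
    have "2 * w 0 = - s" by (simp add: s w_def)
    then have "2 * w i * w 0 / s = w i * (- s) / s" by (metis mult.assoc mult.commute)
    then have "2 * w i * w 0 / s = - w i" using s_pos by simp
    then show "H $$ (i, 0) = v i" using i n by (auto simp: H_def w_def)
  qed
  ultimately show ?thesis using H by blast
qed

text \<open>
  Induction on the dimension: conjugating with the Householder reflection of a unit eigenvector
  splits off a \<open>1 \<times> 1\<close> block, because the first column, and by symmetry the first row, becomes a
  multiple of \<open>e\<^sub>0\<close>.
\<close>
theorem symmetric_mat_orthogonal_diagonalization:
  fixes A :: "real mat"
  assumes "A \<in> carrier_mat n n" and "transpose_mat A = A"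
  shows "\<exists>U. U \<in> carrier_mat n n \<and> transpose_mat U * U = 1\<^sub>m n \<and> diagonal_mat (transpose_mat U * A * U)"
  using assms
proof (induction n arbitrary: A)
  case 0
  then show ?case by (intro exI[of _ "1\<^sub>m 0"]) (auto simp: diagonal_mat_def)
next
  case (Suc n A)
  note A = Suc.prems(1)
  obtain e where "eigenvalue A e"
    using symmetric_mat_real_eigenvalue[OF Suc.prems] by auto
  then obtain v0 where v0: "v0 \<in> carrier_vec (Suc n)" "v0 \<noteq> 0\<^sub>v (Suc n)" "A *\<^sub>v v0 = e \<cdot>\<^sub>v v0"
    using A by (auto simp: eigenvalue_def eigenvector_def)
  define N where "N = (\<Sum>i<Suc n. (vec_index v0 i)\<^sup>2)"
  obtain k where k: "k < Suc n" "vec_index v0 k \<noteq> 0"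
    using v0(1,2) by (metis carrier_vecD eq_vecI index_zero_vec)
  have "0 < (vec_index v0 k)\<^sup>2" using k by simp
  also have "\<dots> \<le> N" unfolding N_def by (rule member_le_sum) (use k in auto)
  finally have N: "0 < N" .
  define v where "v i = vec_index v0 i / sqrt N" for i
  have "(\<Sum>i<Suc n. (v i)\<^sup>2) = 1"
    using N by (simp add: v_def power_divide N_def sum_divide_distrib[symmetric] del: sum.lessThan_Suc)
  then obtain H where H: "H \<in> carrier_mat (Suc n) (Suc n)" "transpose_mat H = H" "H * H = 1\<^sub>m (Suc n)"
      and Hv: "\<forall>i<Suc n. H $$ (i, 0) = v i"
    using householder[of "Suc n" v] by auto
  have ev: "(\<Sum>j<Suc n. A $$ (i, j) * v j) = e * v i" if "i < Suc n" for i
    using arg_cong[OF v0(3), of "\<lambda>x. vec_index x i"] v0(1) A that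
    by (simp add: scalar_prod_def v_def lessThan_atLeast0 sum_divide_distrib[symmetric] del: sum.lessThan_Suc sum.op_ivl_Suc)
  define A' where "A' = H * A * H"
  have A': "A' \<in> carrier_mat (Suc n) (Suc n)" using H A by (auto simp: A'_def)
  have A'_sym: "transpose_mat A' = A'"
    using H A Suc.prems(2)
    by (simp add: A'_def transpose_mult[of _ "Suc n" "Suc n" _ "Suc n"]
        assoc_mult_mat[of _ "Suc n" "Suc n" _ "Suc n" _ "Suc n"])
  have A'_col: "A' $$ (i, 0) = (if i = 0 then e else 0)" if i: "i < Suc n" for i
  proof -
    have AH: "(A * H) $$ (j, 0) = e * H $$ (j, 0)" if "j < Suc n" for j
      using ev[OF that] Hv that A H(1) by (simp add: scalar_prod_def lessThan_atLeast0 del: sum.lessThan_Suc sum.op_ivl_Suc)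
    have "A' $$ (i, 0) = (H * (A * H)) $$ (i, 0)"
      using H A by (simp add: A'_def assoc_mult_mat[of _ "Suc n" "Suc n" _ "Suc n" _ "Suc n"])
    also have "\<dots> = (\<Sum>j<Suc n. H $$ (i, j) * (A * H) $$ (j, 0))"
      using i A H(1) by (simp add: scalar_prod_def lessThan_atLeast0 del: sum.lessThan_Suc sum.op_ivl_Suc index_mult_mat(1) assoc_mult_mat)
         (auto simp: scalar_prod_def)
    also have "\<dots> = e * (\<Sum>j<Suc n. H $$ (i, j) * H $$ (j, 0))"
      unfolding sum_distrib_left by (intro sum.cong refl) (simp only: AH lessThan_iff mult_ac)
    also have "(\<Sum>j<Suc n. H $$ (i, j) * H $$ (j, 0)) = (H * H) $$ (i, 0)"
      using i H(1) by (simp add: scalar_prod_def lessThan_atLeast0 del: sum.lessThan_Suc sum.op_ivl_Suc)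
    also have "\<dots> = (if i = 0 then 1 else 0)" using i by (simp add: H(3))
    finally show ?thesis by simp
  qed
  have A'_row: "A' $$ (0, j) = (if j = 0 then e else 0)" if j: "j < Suc n" for j
    using arg_cong[OF A'_sym, of "\<lambda>B. B $$ (0, j)"] A'_col[OF j] A' j by simp
  define B where "B = Matrix.mat n n (\<lambda>(i, j). A' $$ (Suc i, Suc j))"
  have B: "B \<in> carrier_mat n n" by (simp add: B_def)
  have "transpose_mat B = B"
  proof (rule eq_matI)
    fix i j assume "i < dim_row B" "j < dim_col B"
    then show "transpose_mat B $$ (i, j) = B $$ (i, j)"
      using arg_cong[OF A'_sym, of "\<lambda>B. B $$ (Suc i, Suc j)"] A' by (simp add: B_def)
  qed (auto simp: B_def)
  from Suc.IH[OF B this] obtain V where V: "V \<in> carrier_mat n n" "transpose_mat V * V = 1\<^sub>m n"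
      and VB: "diagonal_mat (transpose_mat V * B * V)" by blast
  define e1 where "e1 = Matrix.mat 1 1 (\<lambda>_. e)"
  define K where "K = four_block_mat (1\<^sub>m 1) (0\<^sub>m 1 n) (0\<^sub>m n 1) V"
  have K: "K \<in> carrier_mat (Suc n) (Suc n)" using V by (auto simp: K_def)
  have e1: "e1 \<in> carrier_mat 1 1" by (simp add: e1_def)
  have A'_block: "A' = four_block_mat e1 (0\<^sub>m 1 n) (0\<^sub>m n 1) B"
    using A' by (intro eq_matI) (auto simp: e1_def B_def A'_col A'_row)
  have KT: "transpose_mat K = four_block_mat (1\<^sub>m 1) (0\<^sub>m 1 n) (0\<^sub>m n 1) (transpose_mat V)"
    using V by (simp add: K_def transpose_four_block_mat[of _ 1 1 _ n _ n])
  have KTA: "transpose_mat K * A' = four_block_mat e1 (0\<^sub>m 1 n) (0\<^sub>m n 1) (transpose_mat V * B)"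
    unfolding KT A'_block using V B e1 by (subst mult_four_block_mat[of _ 1 1 _ n _ n _ _ 1 _ n]) auto
  have KAK: "transpose_mat K * A' * K = four_block_mat e1 (0\<^sub>m 1 n) (0\<^sub>m n 1) (transpose_mat V * B * V)"
    unfolding KTA unfolding K_def using V B e1 by (subst mult_four_block_mat[of _ 1 1 _ n _ n _ _ 1 _ n]) auto
  have KK: "transpose_mat K * K = 1\<^sub>m (Suc n)"
    unfolding KT unfolding K_def using V
    by (subst mult_four_block_mat[of _ 1 1 _ n _ n _ _ 1 _ n]) (auto simp: four_block_one_mat)
  let ?U = "H * K"
  have UT: "transpose_mat ?U = transpose_mat K * H"
    using H K by (simp add: transpose_mult[of _ "Suc n" "Suc n" _ "Suc n"])
  have KT': "transpose_mat K \<in> carrier_mat (Suc n) (Suc n)" using K by auto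
  note assoc = assoc_mult_mat[of _ "Suc n" "Suc n" _ "Suc n" _ "Suc n"]
  have "transpose_mat ?U * ?U = transpose_mat K * ((H * H) * K)"
    unfolding UT using H(1) K KT' by (simp add: assoc)
  also have "\<dots> = 1\<^sub>m (Suc n)" unfolding H(3) using K KK by simp
  finally have "transpose_mat ?U * ?U = 1\<^sub>m (Suc n)" .
  moreover have "transpose_mat ?U * A * ?U = transpose_mat K * A' * K"
    unfolding UT A'_def using H A K KT' by (simp add: assoc)
  moreover have "diagonal_mat (transpose_mat K * A' * K)"
    unfolding KAK using VB V B e1 by (auto simp: diagonal_mat_def)
  ultimately show ?case using H K by (intro exI[of _ ?U]) auto
qed

section \<open>Matrices with a given orthonormal eigenbasis\<close>

text \<open>
  The matrix whose eigenvectors are the columns of \<open>U\<close> and whose eigenvalues are \<open>beta\<close>, that is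
  \<open>U diag(beta) U\<^sup>T\<close>, written entrywise so that traces and norms become manipulations of sums.
\<close>
definition spectral_mat :: "nat \<Rightarrow> real mat \<Rightarrow> (nat \<Rightarrow> real) \<Rightarrow> real mat" where
  "spectral_mat n U beta = Matrix.mat n n (\<lambda>(i, j). \<Sum>k<n. U $$ (i, k) * beta k * U $$ (j, k))"

definition real_orthogonal_mat :: "nat \<Rightarrow> real mat \<Rightarrow> bool" where
  "real_orthogonal_mat n U \<longleftrightarrow> U \<in> carrier_mat n n \<and> transpose_mat U * U = 1\<^sub>m n \<and> U * transpose_mat U = 1\<^sub>m n"

lemma index_mult_mat_sum:
  assumes "A \<in> carrier_mat nr k" "B \<in> carrier_mat k nc" "i < nr" "j < nc"
  shows "(A * B) $$ (i, j) = (\<Sum>l<k. A $$ (i, l) * B $$ (l, j))"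
  using assms by (auto simp: scalar_prod_def lessThan_atLeast0)

lemma sum_lessThan_add_split:
  fixes f :: "nat \<Rightarrow> real"
  shows "(\<Sum>j<m + n. f j) = (\<Sum>j<m. f j) + (\<Sum>j<n. f (m + j))"
  by (induction n) (simp_all add: add.assoc)

lemma real_orthogonal_mat_cols:
  assumes "real_orthogonal_mat n U" "i < n" "k < n"
  shows "(\<Sum>j<n. U $$ (j, i) * U $$ (j, k)) = (if i = k then 1 else 0)"
proof -
  have "(\<Sum>j<n. U $$ (j, i) * U $$ (j, k)) = (transpose_mat U * U) $$ (i, k)"
    using assms by (subst index_mult_mat_sum[of _ n n _ n]) (auto simp: real_orthogonal_mat_def)
  then show ?thesis using assms by (simp add: real_orthogonal_mat_def)
qed

lemma real_orthogonal_mat_rows: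
  assumes "real_orthogonal_mat n U" "i < n" "k < n"
  shows "(\<Sum>j<n. U $$ (i, j) * U $$ (k, j)) = (if i = k then 1 else 0)"
proof -
  have "(\<Sum>j<n. U $$ (i, j) * U $$ (k, j)) = (U * transpose_mat U) $$ (i, k)"
    using assms by (subst index_mult_mat_sum[of _ n n _ n]) (auto simp: real_orthogonal_mat_def)
  then show ?thesis using assms by (simp add: real_orthogonal_mat_def)
qed

lemma spectral_mat_carrier [simp]:
  "spectral_mat n U beta \<in> carrier_mat n n"
  "dim_row (spectral_mat n U beta) = n" "dim_col (spectral_mat n U beta) = n"
  by (simp_all add: spectral_mat_def)

lemma spectral_mat_mult:
  assumes U: "real_orthogonal_mat n U"
  shows "spectral_mat n U beta * spectral_mat n U gam = spectral_mat n U (\<lambda>k. beta k * gam k)"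
proof (rule eq_matI)
  fix i j assume "i < dim_row (spectral_mat n U (\<lambda>k. beta k * gam k))"
    "j < dim_col (spectral_mat n U (\<lambda>k. beta k * gam k))"
  then have ij: "i < n" "j < n" by auto
  have "(spectral_mat n U beta * spectral_mat n U gam) $$ (i, j)
      = (\<Sum>p<n. (\<Sum>k<n. U $$ (i, k) * beta k * U $$ (p, k)) * (\<Sum>l<n. U $$ (p, l) * gam l * U $$ (j, l)))"
    using ij by (simp add: spectral_mat_def scalar_prod_def lessThan_atLeast0)
  also have "\<dots> = (\<Sum>p<n. \<Sum>k<n. \<Sum>l<n. (U $$ (i, k) * beta k * gam l * U $$ (j, l)) * (U $$ (p, k) * U $$ (p, l)))"
    by (simp add: sum_product mult_ac)
  also have "\<dots> = (\<Sum>k<n. \<Sum>l<n. (U $$ (i, k) * beta k * gam l * U $$ (j, l)) * (\<Sum>p<n. U $$ (p, k) * U $$ (p, l)))"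
    by (subst sum.swap, rule sum.cong[OF refl], subst sum.swap) (simp add: sum_distrib_left)
  also have "\<dots> = (\<Sum>k<n. \<Sum>l<n. if l = k then U $$ (i, k) * beta k * gam k * U $$ (j, k) else 0)"
    by (intro sum.cong refl) (auto simp: real_orthogonal_mat_cols[OF U])
  also have "\<dots> = spectral_mat n U (\<lambda>k. beta k * gam k) $$ (i, j)"
    using ij by (simp add: spectral_mat_def mult_ac)
  finally show "(spectral_mat n U beta * spectral_mat n U gam) $$ (i, j)
      = spectral_mat n U (\<lambda>k. beta k * gam k) $$ (i, j)" .
qed auto

lemma spectral_mat_one:
  assumes U: "real_orthogonal_mat n U" and one: "\<And>k. k < n \<Longrightarrow> beta k = 1"
  shows "spectral_mat n U beta = 1\<^sub>m n"
  by (rule eq_matI) (auto simp: spectral_mat_def one real_orthogonal_mat_rows[OF U])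

lemma mat_trace_spectral_mat:
  assumes U: "real_orthogonal_mat n U"
  shows "mat_trace (spectral_mat n U beta) = (\<Sum>k<n. beta k)"
proof -
  have "mat_trace (spectral_mat n U beta) = (\<Sum>i<n. \<Sum>k<n. beta k * (U $$ (i, k) * U $$ (i, k)))"
    by (simp add: mat_trace_def spectral_mat_def mult_ac)
  also have "\<dots> = (\<Sum>k<n. beta k * (\<Sum>i<n. U $$ (i, k) * U $$ (i, k)))"
    by (subst sum.swap) (simp add: sum_distrib_left)
  finally show ?thesis by (simp add: real_orthogonal_mat_cols[OF U])
qed

lemma mat_trace_smult: "mat_trace (c \<cdot>\<^sub>m B) = c * mat_trace B" if "B \<in> carrier_mat n n"
  using that by (auto simp: mat_trace_def sum_distrib_left)

lemma vec_norm2_sum: "v \<in> carrier_vec n \<Longrightarrow> vec_norm2 v = sqrt (\<Sum>i<n. (vec_index v i)\<^sup>2)"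
  by (auto simp: vec_norm2_def scalar_prod_def power2_eq_square lessThan_atLeast0)

lemma vec_norm2_nonneg [simp]: "0 \<le> vec_norm2 v"
  by (auto simp: vec_norm2_def scalar_prod_def intro!: sum_nonneg)

lemma vec_norm2_square: "v \<in> carrier_vec n \<Longrightarrow> (vec_norm2 v)\<^sup>2 = (\<Sum>i<n. (vec_index v i)\<^sup>2)"
  by (auto simp: vec_norm2_sum sum_nonneg)

lemma real_orthogonal_mat_parseval:
  assumes U: "real_orthogonal_mat n U"
  shows "(\<Sum>k<n. (\<Sum>i<n. U $$ (i, k) * x i)\<^sup>2) = (\<Sum>i<n. (x i)\<^sup>2)"
proof -
  have "(\<Sum>k<n. (\<Sum>i<n. U $$ (i, k) * x i)\<^sup>2) = (\<Sum>k<n. \<Sum>i<n. \<Sum>j<n. (U $$ (i, k) * U $$ (j, k)) * (x i * x j))"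
    by (simp add: power2_eq_square sum_product mult_ac)
  also have "\<dots> = (\<Sum>i<n. \<Sum>j<n. (\<Sum>k<n. U $$ (i, k) * U $$ (j, k)) * (x i * x j))"
    by (subst sum.swap, rule sum.cong[OF refl], subst sum.swap) (simp add: sum_distrib_right)
  also have "\<dots> = (\<Sum>i<n. \<Sum>j<n. if j = i then (x i)\<^sup>2 else 0)"
    by (intro sum.cong refl) (auto simp: real_orthogonal_mat_rows[OF U] power2_eq_square)
  finally show ?thesis by simp
qed

lemma real_orthogonal_mat_transpose: "real_orthogonal_mat n U \<Longrightarrow> real_orthogonal_mat n (transpose_mat U)"
  by (auto simp: real_orthogonal_mat_def)

lemma vec_norm2_spectral_mat_mult:
  assumes U: "real_orthogonal_mat n U" and v: "v \<in> carrier_vec n"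
  shows "(vec_norm2 (spectral_mat n U beta *\<^sub>v v))\<^sup>2 = (\<Sum>k<n. (beta k)\<^sup>2 * (\<Sum>i<n. U $$ (i, k) * vec_index v i)\<^sup>2)"
proof -
  have Uc: "U \<in> carrier_mat n n" using U by (simp add: real_orthogonal_mat_def)
  have entry: "vec_index (spectral_mat n U beta *\<^sub>v v) i = (\<Sum>k<n. U $$ (i, k) * (beta k * (\<Sum>j<n. U $$ (j, k) * vec_index v j)))"
    if "i < n" for i
  proof -
    have "vec_index (spectral_mat n U beta *\<^sub>v v) i = (\<Sum>j<n. (\<Sum>k<n. U $$ (i, k) * beta k * U $$ (j, k)) * vec_index v j)"
      using that v by (simp add: spectral_mat_def scalar_prod_def lessThan_atLeast0)
    also have "\<dots> = (\<Sum>k<n. \<Sum>j<n. U $$ (i, k) * beta k * U $$ (j, k) * vec_index v j)"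
      unfolding sum_distrib_right by (rule sum.swap)
    finally show ?thesis by (simp add: sum_distrib_left mult_ac)
  qed
  have "(vec_norm2 (spectral_mat n U beta *\<^sub>v v))\<^sup>2
      = (\<Sum>i<n. (\<Sum>k<n. U $$ (i, k) * (beta k * (\<Sum>j<n. U $$ (j, k) * vec_index v j)))\<^sup>2)"
    using v by (subst vec_norm2_square[of _ n])
      (auto simp: entry simp del: index_mult_mat_vec intro!: mult_mat_vec_carrier[of _ n n])
  also have "\<dots> = (\<Sum>k<n. (beta k * (\<Sum>j<n. U $$ (j, k) * vec_index v j))\<^sup>2)"
    using real_orthogonal_mat_parseval[OF real_orthogonal_mat_transpose[OF U], of "\<lambda>k. beta k * (\<Sum>j<n. U $$ (j, k) * vec_index v j)"] Uc
    by simp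
  finally show ?thesis by (simp add: power_mult_distrib)
qed

lemma op_norm_spectral_mat:
  assumes U: "real_orthogonal_mat n U" and n: "0 < n" and beta: "\<And>k. k < n \<Longrightarrow> 0 \<le> beta k"
  shows "op_norm (spectral_mat n U beta) = Max (beta ` {..<n})"
proof -
  let ?B = "spectral_mat n U beta"
  define b where "b = Max (beta ` {..<n})"
  let ?V = "{v \<in> carrier_vec n. vec_norm2 v \<le> 1}"
  have Uc: "U \<in> carrier_mat n n" using U by (simp add: real_orthogonal_mat_def)
  have "b \<in> beta ` {..<n}" unfolding b_def using n by (intro Max_in) auto
  then obtain k where k: "k < n" "b = beta k" by auto
  have le: "beta l \<le> b" if "l < n" for l unfolding b_def using that by (intro Max_ge) auto
  have upper: "vec_norm2 (?B *\<^sub>v v) \<le> b" if v: "v \<in> ?V" for v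
  proof (rule power2_le_imp_le)
    have "(vec_norm2 (?B *\<^sub>v v))\<^sup>2 \<le> (\<Sum>l<n. b\<^sup>2 * (\<Sum>i<n. U $$ (i, l) * vec_index v i)\<^sup>2)"
      using v le beta by (subst vec_norm2_spectral_mat_mult[OF U])
        (auto intro!: sum_mono mult_right_mono power_mono)
    also have "\<dots> = b\<^sup>2 * (vec_norm2 v)\<^sup>2"
      using v by (simp add: sum_distrib_left[symmetric] real_orthogonal_mat_parseval[OF U] vec_norm2_square[of _ n])
    also have "\<dots> \<le> b\<^sup>2 * 1\<^sup>2"
      using v by (intro mult_left_mono power_mono) auto
    finally show "(vec_norm2 (?B *\<^sub>v v))\<^sup>2 \<le> b\<^sup>2" by simp
    show "0 \<le> b" using k beta by auto
  qed
  have colk: "col U k \<in> ?V"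
    using Uc k(1) real_orthogonal_mat_cols[OF U k(1) k(1)] by (auto simp: vec_norm2_sum[of _ n] power2_eq_square)
  have "(vec_norm2 (?B *\<^sub>v col U k))\<^sup>2 = (\<Sum>l<n. (beta l)\<^sup>2 * (\<Sum>i<n. U $$ (i, l) * U $$ (i, k))\<^sup>2)"
    using Uc k(1) by (subst vec_norm2_spectral_mat_mult[OF U]) auto
  also have "\<dots> = (\<Sum>l<n. if l = k then (beta k)\<^sup>2 else 0)"
    by (intro sum.cong refl) (use k(1) in \<open>auto simp: real_orthogonal_mat_cols[OF U]\<close>)
  also have "\<dots> = b\<^sup>2" using k by simp
  finally have "vec_norm2 (?B *\<^sub>v col U k) = b"
    by (rule power2_eq_imp_eq) (simp_all add: k beta)
  then have attained: "b \<in> (\<lambda>v. vec_norm2 (?B *\<^sub>v v)) ` ?V"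
    using colk by (metis (no_types, lifting) image_eqI)
  show ?thesis
    unfolding b_def[symmetric] op_norm_def spectral_mat_carrier
    using cSup_eq_maximum[OF attained] upper by blast
qed

section \<open>Diagonalising the penalised Fisher information\<close>

text \<open>
  The coefficients \<open>r U j k\<close> describe the augmented experiment in the eigenbasis: for \<open>j < m\<close> they are
  the signal-to-noise coefficients of the given observation, and the further \<open>n\<close> rows belong to the
  additional observation \<open>\<mu>\<^sup>1\<^sup>/\<^sup>2 G f + \<xi>\<close>.  Their Gram matrix is \<open>U\<^sup>T (F + \<mu> G\<^sup>2) U\<close>, which is
  diagonal when \<open>U\<close> diagonalises \<open>F\<^sub>\<mu>\<close>.  The eigenvalues of \<open>F\<^sub>\<mu>\<close> are positive since they are sums of
  squares and \<open>F\<^sub>\<mu>\<close> has trivial kernel.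
\<close>
lemma penalized_fisher_diagonalization:
  assumes A: "A \<in> carrier_mat m n" and sigma: "0 < \<sigma>" and G: "G \<in> carrier_mat n n"
    and G_sym: "transpose_mat G = G" and mu: "0 \<le> \<mu>" and Finv: "Finv \<in> carrier_mat n n"
    and inv: "Fisher_pen A \<sigma> (G * G) \<mu> * Finv = 1\<^sub>m n" "Finv * Fisher_pen A \<sigma> (G * G) \<mu> = 1\<^sub>m n"
  defines "r \<equiv> \<lambda>U j k. if j < m then (A * U) $$ (j, k) / \<sigma> else sqrt \<mu> * (G * U) $$ (j - m, k)"
  shows "\<exists>U beta. real_orthogonal_mat n U \<and> (\<forall>k<n. 0 < beta k) \<and> Finv = spectral_mat n U beta \<and>
    (\<forall>i<n. \<forall>k<n. (\<Sum>j<m + n. r U j i * r U j k) = (if i = k then 1 / beta i else 0))"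
proof -
  let ?F = "Fisher_pen A \<sigma> (G * G) \<mu>"
  have At: "transpose_mat A \<in> carrier_mat n m" using A by auto
  have AtA: "transpose_mat A * A \<in> carrier_mat n n" and GG: "G * G \<in> carrier_mat n n"
    using A G by auto
  have F: "?F \<in> carrier_mat n n" using A G by (auto simp: Fisher_pen_def Fisher_def)
  have AtA_sym: "transpose_mat (transpose_mat A * A) = transpose_mat A * A"
    using A by (simp add: transpose_mult[OF At A])
  have GG_sym: "transpose_mat (G * G) = G * G"
    using G_sym by (simp add: transpose_mult[OF G G])
  have "transpose_mat ?F = ?F"
  proof (rule eq_matI)
    fix i j assume "i < dim_row ?F" "j < dim_col ?F"
    then have ij: "i < n" "j < n" using F by auto
    then show "transpose_mat ?F $$ (i, j) = ?F $$ (i, j)"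
      using arg_cong[OF AtA_sym, of "\<lambda>B. B $$ (i, j)"] arg_cong[OF GG_sym, of "\<lambda>B. B $$ (i, j)"] A G AtA GG
      by (simp add: Fisher_pen_def Fisher_def del: index_mult_mat(1))
  qed (use F in auto)
  then obtain U where Uc: "U \<in> carrier_mat n n" and UU: "transpose_mat U * U = 1\<^sub>m n"
      and diag: "diagonal_mat (transpose_mat U * ?F * U)"
    using symmetric_mat_orthogonal_diagonalization[OF F] by blast
  have Ut: "transpose_mat U \<in> carrier_mat n n" using Uc by auto
  have UU': "U * transpose_mat U = 1\<^sub>m n" by (rule mat_mult_left_right_inverse[OF Ut Uc UU])
  have U: "real_orthogonal_mat n U" using Uc UU UU' by (simp add: real_orthogonal_mat_def)
  define D where "D = transpose_mat U * ?F * U"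
  define d where "d k = D $$ (k, k)" for k
  have D: "D \<in> carrier_mat n n" using Uc F by (auto simp: D_def)
  have D_entry: "D $$ (i, k) = (if i = k then d i else 0)" if "i < n" "k < n" for i k
    using diag that D unfolding D_def[symmetric] diagonal_mat_def d_def by auto
  note assoc = assoc_mult_mat[of _ n n _ n _ n]
  have "U * D * transpose_mat U = (U * transpose_mat U) * (?F * (U * transpose_mat U))"
    unfolding D_def using Uc Ut F by (simp add: assoc del: assoc_mult_mat)
  then have UDU: "U * D * transpose_mat U = ?F" unfolding UU' using F by simp
  have F_spec: "?F = spectral_mat n U d"
  proof (rule eq_matI)
    fix i j assume "i < dim_row (spectral_mat n U d)" "j < dim_col (spectral_mat n U d)"
    then have ij: "i < n" "j < n" by auto
    have UD: "(U * D) $$ (i, k) = U $$ (i, k) * d k" if k: "k < n" for k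
    proof -
      have "(U * D) $$ (i, k) = (\<Sum>l<n. U $$ (i, l) * D $$ (l, k))"
        using ij k Uc D by (intro index_mult_mat_sum) auto
      also have "\<dots> = (\<Sum>l<n. if l = k then U $$ (i, k) * d k else 0)"
        using k by (intro sum.cong refl) (auto simp: D_entry)
      finally show ?thesis using k by simp
    qed
    have "?F $$ (i, j) = (U * D * transpose_mat U) $$ (i, j)" by (simp only: UDU)
    also have "\<dots> = (\<Sum>k<n. (U * D) $$ (i, k) * transpose_mat U $$ (k, j))"
      using ij Uc D by (intro index_mult_mat_sum[of _ n n _ n]) auto
    also have "\<dots> = (\<Sum>k<n. U $$ (i, k) * d k * U $$ (j, k))"
      using ij Uc by (intro sum.cong refl) (simp add: UD del: index_mult_mat(1))
    finally have "?F $$ (i, j) = (\<Sum>k<n. U $$ (i, k) * d k * U $$ (j, k))" .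
    then show "?F $$ (i, j) = spectral_mat n U d $$ (i, j)"
      using ij by (simp add: spectral_mat_def)
  qed (use F in auto)
  have gram: "(\<Sum>j<m + n. r U j i * r U j k) = D $$ (i, k)" if ik: "i < n" "k < n" for i k
  proof -
    have AU: "A * U \<in> carrier_mat m n" and GU: "G * U \<in> carrier_mat n n" using A G Uc by auto
    have AUt: "transpose_mat (A * U) = transpose_mat U * transpose_mat A"
      by (rule transpose_mult[OF A Uc])
    have GUt: "transpose_mat (G * U) = transpose_mat U * G"
      unfolding transpose_mult[OF G Uc] G_sym ..
    have "transpose_mat U * (transpose_mat A * A) * U = transpose_mat (A * U) * (A * U)"
      unfolding AUt assoc_mult_mat[OF Ut AtA Uc] assoc_mult_mat[OF At A Uc] assoc_mult_mat[OF Ut At AU] ..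
    moreover have "transpose_mat U * (G * G) * U = transpose_mat (G * U) * (G * U)"
      unfolding GUt assoc_mult_mat[OF Ut GG Uc] assoc_mult_mat[OF G G Uc] assoc_mult_mat[OF Ut G GU] ..
    moreover have "D = (1 / \<sigma>\<^sup>2) \<cdot>\<^sub>m (transpose_mat U * (transpose_mat A * A) * U) + \<mu> \<cdot>\<^sub>m (transpose_mat U * (G * G) * U)"
    proof -
      have "transpose_mat U * ((1 / \<sigma>\<^sup>2) \<cdot>\<^sub>m (transpose_mat A * A) + \<mu> \<cdot>\<^sub>m (G * G))
          = (1 / \<sigma>\<^sup>2) \<cdot>\<^sub>m (transpose_mat U * (transpose_mat A * A)) + \<mu> \<cdot>\<^sub>m (transpose_mat U * (G * G))"
        unfolding mult_add_distrib_mat[OF Ut smult_carrier_mat[OF AtA] smult_carrier_mat[OF GG]]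
          mult_smult_distrib[OF Ut AtA] mult_smult_distrib[OF Ut GG] ..
      then show ?thesis
        unfolding D_def Fisher_pen_def Fisher_def
        using add_mult_distrib_mat[OF smult_carrier_mat[OF mult_carrier_mat[OF Ut AtA]]
            smult_carrier_mat[OF mult_carrier_mat[OF Ut GG]] Uc]
          mult_smult_assoc_mat[OF mult_carrier_mat[OF Ut AtA] Uc]
          mult_smult_assoc_mat[OF mult_carrier_mat[OF Ut GG] Uc]
        by (simp only:)
    qed
    ultimately have "D $$ (i, k) = 1 / \<sigma>\<^sup>2 * (transpose_mat (A * U) * (A * U)) $$ (i, k) + \<mu> * (transpose_mat (G * U) * (G * U)) $$ (i, k)"
      using ik AU GU A G Uc by (simp del: index_mult_mat(1))
    also have "(transpose_mat (A * U) * (A * U)) $$ (i, k) = (\<Sum>j<m. (A * U) $$ (j, i) * (A * U) $$ (j, k))"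
      using ik AU A Uc by (subst index_mult_mat_sum[of _ n m _ n]) (auto simp del: index_mult_mat(1))
    also have "(transpose_mat (G * U) * (G * U)) $$ (i, k) = (\<Sum>j<n. (G * U) $$ (j, i) * (G * U) $$ (j, k))"
      using ik GU G Uc by (subst index_mult_mat_sum[of _ n n _ n]) (auto simp del: index_mult_mat(1))
    finally have D_ik: "D $$ (i, k) = 1 / \<sigma>\<^sup>2 * (\<Sum>j<m. (A * U) $$ (j, i) * (A * U) $$ (j, k)) + \<mu> * (\<Sum>j<n. (G * U) $$ (j, i) * (G * U) $$ (j, k))" .
    have "(\<Sum>j<m + n. r U j i * r U j k) = (\<Sum>j<m. r U j i * r U j k) + (\<Sum>j<n. r U (m + j) i * r U (m + j) k)"
      by (rule sum_lessThan_add_split)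
    also have "(\<Sum>j<m. r U j i * r U j k) = 1 / \<sigma>\<^sup>2 * (\<Sum>j<m. (A * U) $$ (j, i) * (A * U) $$ (j, k))"
      unfolding r_def sum_distrib_left by (intro sum.cong refl) (simp add: power2_eq_square del: index_mult_mat(1))
    also have "(\<Sum>j<n. r U (m + j) i * r U (m + j) k) = \<mu> * (\<Sum>j<n. (G * U) $$ (j, i) * (G * U) $$ (j, k))"
      unfolding r_def sum_distrib_left using mu
      by (intro sum.cong refl) (simp add: mult_ac del: index_mult_mat(1))
    finally show ?thesis unfolding D_ik .
  qed
  have d_pos: "0 < d k" if k: "k < n" for k
  proof -
    have "d k = (\<Sum>j<m + n. (r U j k)\<^sup>2)" unfolding d_def gram[OF k k, symmetric] by (simp add: power2_eq_square)
    then have "0 \<le> d k" by (simp add: sum_nonneg)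
    moreover have "d k \<noteq> 0"
    proof
      assume d0: "d k = 0"
      have "vec_norm2 (?F *\<^sub>v col U k) = 0"
      proof -
        have "(vec_norm2 (?F *\<^sub>v col U k))\<^sup>2 = (\<Sum>l<n. (d l)\<^sup>2 * (\<Sum>i<n. U $$ (i, l) * U $$ (i, k))\<^sup>2)"
          unfolding F_spec using Uc k by (subst vec_norm2_spectral_mat_mult[OF U]) auto
        also have "\<dots> = 0" by (intro sum.neutral) (use k d0 in \<open>auto simp: real_orthogonal_mat_cols[OF U]\<close>)
        finally show ?thesis by simp
      qed
      then have "(\<Sum>i<n. (vec_index (?F *\<^sub>v col U k) i)\<^sup>2) = 0"
        using F Uc k vec_norm2_square[of "?F *\<^sub>v col U k" n] by (auto simp del: index_mult_mat_vec)
      then have "\<forall>i<n. vec_index (?F *\<^sub>v col U k) i = 0"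
        by (subst (asm) sum_nonneg_eq_0_iff) (auto simp del: index_mult_mat_vec)
      then have F0: "?F *\<^sub>v col U k = 0\<^sub>v n" using F by (intro eq_vecI) (auto simp del: index_mult_mat_vec)
      have "col U k = (Finv * ?F) *\<^sub>v col U k" unfolding inv(2) using Uc k by simp
      also have "\<dots> = Finv *\<^sub>v (?F *\<^sub>v col U k)" using Finv F Uc k by (intro assoc_mult_mat_vec) auto
      also have "\<dots> = 0\<^sub>v n" unfolding F0 using Finv by (intro eq_vecI) auto
      finally have col0: "col U k = 0\<^sub>v n" .
      have "U $$ (i, k) = 0" if i: "i < n" for i
      proof -
        have "U $$ (i, k) = vec_index (col U k) i" using i k Uc by simp
        then show ?thesis using i by (simp add: col0)
      qed
      then show False using real_orthogonal_mat_cols[OF U k k] by simp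
    qed
    ultimately show ?thesis by simp
  qed
  have "?F * spectral_mat n U (\<lambda>k. 1 / d k) = 1\<^sub>m n"
    unfolding F_spec spectral_mat_mult[OF U] by (rule spectral_mat_one[OF U]) (use d_pos in force)
  then have "Finv * (?F * spectral_mat n U (\<lambda>k. 1 / d k)) = Finv" using Finv by simp
  moreover have "Finv * (?F * spectral_mat n U (\<lambda>k. 1 / d k)) = (Finv * ?F) * spectral_mat n U (\<lambda>k. 1 / d k)"
    using Finv F by (simp add: assoc)
  ultimately have "Finv = spectral_mat n U (\<lambda>k. 1 / d k)" unfolding inv(2) by simp
  then show ?thesis
    using U d_pos by (intro exI[of _ U] exI[of _ "\<lambda>k. 1 / d k"]) (simp add: gram D_entry)
qed

section \<open>Gaussian integrals\<close>

lemma nn_integral_gaussian: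
  fixes q m :: real
  assumes q: "0 < q"
  shows "(\<integral>\<^sup>+x. ennreal (exp (- (q * (x - m)\<^sup>2) / 2)) \<partial>lborel) = ennreal (sqrt (2 * pi / q))"
proof -
  have sq: "(1 / sqrt q)\<^sup>2 = 1 / q" using q by (simp add: power_divide)
  interpret prob_space "density lborel (normal_density m (1 / sqrt q))"
    by (rule prob_space_normal_density) (use q in simp)
  have "exp (- (q * (x - m)\<^sup>2) / 2) = sqrt (2 * pi / q) * normal_density m (1 / sqrt q) x" for x
    using q by (simp add: normal_density_def sq real_sqrt_divide)
  then have "(\<integral>\<^sup>+x. ennreal (exp (- (q * (x - m)\<^sup>2) / 2)) \<partial>lborel)
      = (\<integral>\<^sup>+x. ennreal (sqrt (2 * pi / q)) * ennreal (normal_density m (1 / sqrt q) x) \<partial>lborel)"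
    by (simp add: ennreal_mult'')
  also have "\<dots> = ennreal (sqrt (2 * pi / q)) * (\<integral>\<^sup>+x. ennreal (normal_density m (1 / sqrt q) x) \<partial>lborel)"
    by (rule nn_integral_cmult) simp
  also have "(\<integral>\<^sup>+x. ennreal (normal_density m (1 / sqrt q) x) \<partial>lborel) = 1"
    using emeasure_space_1 by (simp add: emeasure_density)
  finally show ?thesis by simp
qed

text \<open>
  Completing the square, \<open>q (x - m)\<^sup>2 + lam (a - x)\<^sup>2\<close> is \<open>(q + lam) (x - m')\<^sup>2\<close> plus a nonnegative
  constant that vanishes when \<open>a = m\<close>: the Laplace transform of the squared loss is
  largest for the guess at the centre of the Gaussian.
\<close>
lemma gaussian_small_ball_1d:
  fixes q lam a c :: real
  assumes q: "0 < q" and lam: "0 < lam"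
  shows "(\<integral>\<^sup>+x. ennreal (exp (c * x - q * x\<^sup>2 / 2) * exp (- (lam * (a - x)\<^sup>2) / 2)) \<partial>lborel)
    \<le> ennreal (sqrt (q / (q + lam))) * (\<integral>\<^sup>+x. ennreal (exp (c * x - q * x\<^sup>2 / 2)) \<partial>lborel)"
proof -
  define m where "m = c / q"
  define m' where "m' = (lam * a + q * m) / (q + lam)"
  define E where "E = exp (q * m\<^sup>2 / 2)"
  have c: "c = q * m" using q by (simp add: m_def)
  have complete: "exp (c * x - q * x\<^sup>2 / 2) = E * exp (- (q * (x - m)\<^sup>2) / 2)" for x
    unfolding E_def exp_add[symmetric] by (simp add: c power2_eq_square field_simps)
  have joint: "exp (c * x - q * x\<^sup>2 / 2) * exp (- (lam * (a - x)\<^sup>2) / 2)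
      \<le> E * exp (- ((q + lam) * (x - m')\<^sup>2) / 2)" for x
  proof -
    have "q * (x - m)\<^sup>2 + lam * (a - x)\<^sup>2 - (q + lam) * (x - m')\<^sup>2 = q * lam / (q + lam) * (a - m)\<^sup>2"
    proof -
      have m'q: "(q + lam) * m' = lam * a + q * m" using q lam by (simp add: m'_def)
      have "(q + lam) * (q * (x - m)\<^sup>2 + lam * (a - x)\<^sup>2 - (q + lam) * (x - m')\<^sup>2)
          = (q + lam) * (q * (x - m)\<^sup>2 + lam * (a - x)\<^sup>2) - ((q + lam) * x - (q + lam) * m')\<^sup>2"
        by (simp add: power2_eq_square algebra_simps)
      also have "\<dots> = q * lam * (a - m)\<^sup>2"
        unfolding m'q by (simp add: power2_eq_square algebra_simps)
      finally show ?thesis using q lam by (simp add: field_simps)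
    qed
    moreover have "0 \<le> q * lam / (q + lam) * (a - m)\<^sup>2" using q lam by simp
    ultimately have "- (q * (x - m)\<^sup>2) / 2 + - (lam * (a - x)\<^sup>2) / 2 \<le> - ((q + lam) * (x - m')\<^sup>2) / 2"
      by linarith
    then have "exp (- (q * (x - m)\<^sup>2) / 2) * exp (- (lam * (a - x)\<^sup>2) / 2) \<le> exp (- ((q + lam) * (x - m')\<^sup>2) / 2)"
      by (simp only: exp_add[symmetric] exp_le_cancel_iff)
    then show ?thesis unfolding complete mult.assoc
      by (rule mult_left_mono) (simp add: E_def)
  qed
  have "(\<integral>\<^sup>+x. ennreal (exp (c * x - q * x\<^sup>2 / 2) * exp (- (lam * (a - x)\<^sup>2) / 2)) \<partial>lborel)
      \<le> (\<integral>\<^sup>+x. ennreal E * ennreal (exp (- ((q + lam) * (x - m')\<^sup>2) / 2)) \<partial>lborel)"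
  proof (rule nn_integral_mono)
    fix x
    show "ennreal (exp (c * x - q * x\<^sup>2 / 2) * exp (- (lam * (a - x)\<^sup>2) / 2))
        \<le> ennreal E * ennreal (exp (- ((q + lam) * (x - m')\<^sup>2) / 2))"
      using ennreal_leI[OF joint[of x]] by (simp add: ennreal_mult E_def)
  qed
  also have "\<dots> = ennreal E * ennreal (sqrt (2 * pi / (q + lam)))"
    by (subst nn_integral_cmult, simp, subst nn_integral_gaussian) (use q lam in auto)
  also have "sqrt (2 * pi / (q + lam)) = sqrt (q / (q + lam)) * sqrt (2 * pi / q)"
    using q by (simp flip: real_sqrt_mult)
  also have "ennreal E * ennreal (sqrt (q / (q + lam)) * sqrt (2 * pi / q)) =
      ennreal (sqrt (q / (q + lam))) * (ennreal E * ennreal (sqrt (2 * pi / q)))"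
    using q lam by (simp add: ennreal_mult mult_ac)
  also have "ennreal E * ennreal (sqrt (2 * pi / q)) = (\<integral>\<^sup>+x. ennreal (exp (c * x - q * x\<^sup>2 / 2)) \<partial>lborel)"
    unfolding complete
    by (subst nn_integral_gaussian[OF q, symmetric, of m], subst nn_integral_cmult[symmetric])
      (simp_all add: ennreal_mult E_def)
  finally show ?thesis .
qed

text \<open>
  The law of \<open>c + e\<close> with standard Gaussian \<open>e\<close> has the translated density with respect to the
  product Lebesgue measure; the two measures agree on boxes because the one-dimensional marginals do.
\<close>
lemma nn_integral_gaussian_shift:
  fixes c :: "'j \<Rightarrow> real"
  assumes J: "finite J" and h[measurable]: "h \<in> borel_measurable (\<Pi>\<^sub>M j\<in>J. (borel :: real measure))"
  shows "(\<integral>\<^sup>+e. h (\<lambda>j\<in>J. c j + e j) \<partial>(\<Pi>\<^sub>M j\<in>J. std_normal_distribution))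
    = (\<integral>\<^sup>+w. (\<Prod>j\<in>J. ennreal (std_normal_density (w j - c j))) * h w \<partial>(\<Pi>\<^sub>M j\<in>J. lborel))"
proof -
  let ?S = "\<Pi>\<^sub>M j\<in>J. std_normal_distribution" and ?B = "\<Pi>\<^sub>M j\<in>J. (borel :: real measure)"
  let ?L = "\<Pi>\<^sub>M j\<in>J. (lborel :: real measure)"
  let ?shift = "\<lambda>e. \<lambda>j\<in>J. c j + e j"
  let ?p = "\<lambda>w. \<Prod>j\<in>J. ennreal (std_normal_density (w j - c j))"
  define N where "N j = distr std_normal_distribution borel (\<lambda>x. c j + x)" for j
  have normal: "prob_space std_normal_distribution"
    by (rule real_distribution.axioms(1)[OF real_dist_normal_dist])
  interpret S: product_prob_space "\<lambda>_. std_normal_distribution" J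
    by (rule product_prob_spaceI) (rule normal)
  have N: "prob_space (N j)" for j
    unfolding N_def by (rule prob_space.prob_space_distr[OF normal]) simp
  interpret N: product_prob_space N J
    by (rule product_prob_spaceI) (rule N)
  interpret L: product_sigma_finite "\<lambda>_. lborel :: real measure"
    by standard
  have setsN: "sets (N j) = sets borel" for j by (simp add: N_def)
  have N_eq: "emeasure (N j) A = (\<integral>\<^sup>+x. ennreal (std_normal_density (x - c j)) * indicator A x \<partial>lborel)"
    if A[measurable]: "A \<in> sets borel" for A j
  proof -
    have "emeasure (N j) A = (\<integral>\<^sup>+x. indicator A x \<partial>N j)"
      by (rule nn_integral_indicator[symmetric]) (simp add: setsN)
    also have "\<dots> = (\<integral>\<^sup>+x. indicator A (c j + x) \<partial>std_normal_distribution)"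
      unfolding N_def by (rule nn_integral_distr) measurable
    also have "\<dots> = (\<integral>\<^sup>+x. ennreal (std_normal_density x) * indicator A (c j + x) \<partial>lborel)"
      by (rule nn_integral_density) measurable
    also have "\<dots> = (\<integral>\<^sup>+x. ennreal (std_normal_density (- c j + 1 * x)) * indicator A (c j + (- c j + 1 * x)) \<partial>lborel)"
      by (subst nn_integral_real_affine[of _ 1 "- c j"]) simp_all
    finally show ?thesis by simp
  qed
  have shift_m[measurable]: "?shift \<in> measurable ?S ?B"
    by (rule measurable_restrict) measurable
  have p_m[measurable]: "?p \<in> borel_measurable ?L"
    by measurable
  have sets_SB: "sets ?S = sets ?B" by (intro sets_PiM_cong) auto
  have sets_LB: "sets ?L = sets ?B" by (intro sets_PiM_cong) auto
  have sets_BN: "sets ?B = sets (PiM J N)" by (intro sets_PiM_cong) (auto simp: setsN)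
  have "distr ?S ?B ?shift = PiM J N"
  proof (rule N.PiM_eqI)
    show "sets (distr ?S ?B ?shift) = sets (PiM J N)" by (simp add: sets_BN)
    fix A assume A: "\<And>i. i \<in> J \<Longrightarrow> A i \<in> sets (N i)"
    have box: "Pi\<^sub>E J A \<in> sets ?B" by (rule sets_PiM_I_finite[OF J]) (use A setsN in auto)
    have "emeasure (distr ?S ?B ?shift) (Pi\<^sub>E J A) = emeasure ?S (?shift -` (Pi\<^sub>E J A) \<inter> space ?S)"
      by (rule emeasure_distr[OF shift_m box])
    also have "?shift -` (Pi\<^sub>E J A) \<inter> space ?S = Pi\<^sub>E J (\<lambda>j. (\<lambda>x. c j + x) -` A j)"
      by (auto simp: space_PiM PiE_iff)
    also have "emeasure ?S \<dots> = (\<Prod>j\<in>J. emeasure std_normal_distribution ((\<lambda>x. c j + x) -` A j))"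
    proof (rule S.emeasure_PiM[OF J])
      fix j assume "j \<in> J"
      then have [measurable]: "A j \<in> sets borel" using A setsN by auto
      show "(\<lambda>x. c j + x) -` A j \<in> sets std_normal_distribution"
        using measurable_sets[of "\<lambda>x. c j + x" borel borel "A j"] by simp
    qed
    also have "\<dots> = (\<Prod>j\<in>J. emeasure (N j) (A j))"
      using A by (intro prod.cong refl) (simp add: N_def emeasure_distr)
    finally show "emeasure (distr ?S ?B ?shift) (Pi\<^sub>E J A) = (\<Prod>j\<in>J. emeasure (N j) (A j))" .
  qed (rule J)
  moreover have "density ?L ?p = PiM J N"
  proof (rule N.PiM_eqI)
    show "sets (density ?L ?p) = sets (PiM J N)" by (simp add: sets_BN[symmetric] sets_LB)
    fix A assume A: "\<And>i. i \<in> J \<Longrightarrow> A i \<in> sets (N i)"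
    then have A': "\<And>i. i \<in> J \<Longrightarrow> A i \<in> sets borel" by (simp add: setsN)
    have box: "Pi\<^sub>E J A \<in> sets ?L" by (rule sets_PiM_I_finite[OF J]) (use A' in auto)
    have "emeasure (density ?L ?p) (Pi\<^sub>E J A) = (\<integral>\<^sup>+w. ?p w * indicator (Pi\<^sub>E J A) w \<partial>?L)"
      by (rule emeasure_density[OF p_m box])
    also have "\<dots> = (\<integral>\<^sup>+w. (\<Prod>j\<in>J. ennreal (std_normal_density (w j - c j)) * indicator (A j) (w j)) \<partial>?L)"
    proof (rule nn_integral_cong)
      fix w assume "w \<in> space ?L"
      then have "w \<in> extensional J" by (auto simp: space_PiM PiE_iff)
      then have "(indicator (Pi\<^sub>E J A) w :: ennreal) = (\<Prod>j\<in>J. indicator (A j) (w j))"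
        using J by (auto simp: indicator_def PiE_iff prod.neutral prod_zero_iff)
      then show "?p w * indicator (Pi\<^sub>E J A) w = (\<Prod>j\<in>J. ennreal (std_normal_density (w j - c j)) * indicator (A j) (w j))"
        by (simp add: prod.distrib)
    qed
    also have "\<dots> = (\<Prod>j\<in>J. \<integral>\<^sup>+x. ennreal (std_normal_density (x - c j)) * indicator (A j) x \<partial>lborel)"
      by (rule L.product_nn_integral_prod[OF J]) (use A' in measurable)
    also have "\<dots> = (\<Prod>j\<in>J. emeasure (N j) (A j))"
      using A' by (intro prod.cong refl) (simp add: N_eq)
    finally show "emeasure (density ?L ?p) (Pi\<^sub>E J A) = (\<Prod>j\<in>J. emeasure (N j) (A j))" .
  qed (rule J)
  ultimately have eq: "distr ?S ?B ?shift = density ?L ?p" by simp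
  have hL: "h \<in> borel_measurable ?L" using h by (subst measurable_cong_sets[OF sets_LB refl])
  have "(\<integral>\<^sup>+e. h (?shift e) \<partial>?S) = (\<integral>\<^sup>+w. h w \<partial>distr ?S ?B ?shift)"
    by (rule nn_integral_distr[OF shift_m, symmetric]) (use h in simp)
  also have "\<dots> = (\<integral>\<^sup>+w. ?p w * h w \<partial>?L)"
    unfolding eq by (rule nn_integral_density[OF p_m hL])
  finally show ?thesis .
qed

text \<open>
  Chernoff's bound with parameter \<open>1/4\<close>: each factor satisfies
  \<open>E exp (u z\<^sup>2 / 4) = (1 - u / 2) powr (- 1/2) \<le> exp (u / 2)\<close> for \<open>u \<le> 1\<close>, so the probability is at
  most \<open>exp (- 2 x + x / 2)\<close> with \<open>x = \<Sum>u\<^sub>i\<close>.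
\<close>
lemma gaussian_weighted_chi_square_tail:
  fixes u :: "nat \<Rightarrow> real"
  assumes u: "\<And>i. i < n \<Longrightarrow> 0 \<le> u i \<and> u i \<le> 1"
  shows "emeasure (\<Pi>\<^sub>M i\<in>{..<n}. std_normal_distribution)
      {z \<in> space (\<Pi>\<^sub>M i\<in>{..<n}. std_normal_distribution). 8 * (\<Sum>i<n. u i) < (\<Sum>i<n. u i * (z i)\<^sup>2)}
    \<le> ennreal (exp (- (3 / 2) * (\<Sum>i<n. u i)))"
    (is "emeasure ?S ?T \<le> _")
proof -
  define x where "x = (\<Sum>i<n. u i)"
  have normal: "prob_space std_normal_distribution"
    by (rule real_distribution.axioms(1)[OF real_dist_normal_dist])
  interpret S: product_prob_space "\<lambda>_. std_normal_distribution" "{..<n}"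
    by (rule product_prob_spaceI) (rule normal)
  have mgf: "(\<integral>\<^sup>+z. ennreal (exp (u i * z\<^sup>2 / 4)) \<partial>std_normal_distribution) \<le> ennreal (exp (u i / 2))"
    if i: "i < n" for i
  proof -
    define q where "q = 1 - u i / 2"
    have q: "1 / 2 \<le> q" using u[OF i] by (simp add: q_def)
    have dens: "std_normal_density z * exp (u i * z\<^sup>2 / 4) = 1 / sqrt (2 * pi) * exp (- (q * (z - 0)\<^sup>2) / 2)" for z
      unfolding std_normal_density_def mult.assoc exp_add[symmetric] by (simp add: q_def field_simps)
    have "(\<integral>\<^sup>+z. ennreal (exp (u i * z\<^sup>2 / 4)) \<partial>std_normal_distribution)
        = (\<integral>\<^sup>+z. ennreal (std_normal_density z) * ennreal (exp (u i * z\<^sup>2 / 4)) \<partial>lborel)"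
      by (rule nn_integral_density) measurable
    also have "\<dots> = (\<integral>\<^sup>+z. ennreal (1 / sqrt (2 * pi)) * ennreal (exp (- (q * (z - 0)\<^sup>2) / 2)) \<partial>lborel)"
      by (intro nn_integral_cong, subst (1 2) ennreal_mult[symmetric]) (simp_all only: dens, simp_all)
    also have "\<dots> = ennreal (1 / sqrt (2 * pi)) * ennreal (sqrt (2 * pi / q))"
      by (subst nn_integral_cmult, simp, subst nn_integral_gaussian) (use q in auto)
    also have "\<dots> = ennreal (sqrt (1 / q))"
      using q by (simp add: ennreal_mult[symmetric] real_sqrt_divide)
    also have "sqrt (1 / q) \<le> exp (u i / 2)"
    proof (rule real_le_lsqrt)
      have "- (u i / 2) - 2 * (u i / 2)\<^sup>2 \<le> ln (1 - u i / 2)"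
        using u[OF i] by (intro ln_one_minus_pos_lower_bound) auto
      moreover have "2 * (u i / 2)\<^sup>2 \<le> u i / 2"
        using u[OF i] by (simp add: power2_eq_square mult_left_le)
      ultimately have "- u i \<le> ln q" by (simp add: q_def)
      then have "exp (- u i) \<le> q" using q by (subst (asm) ln_ge_iff) auto
      then have "1 / q \<le> exp (u i)" using q by (simp add: exp_minus field_simps)
      also have "exp (u i) = (exp (u i / 2))\<^sup>2" by (simp add: power2_eq_square flip: exp_add)
      finally show "1 / q \<le> (exp (u i / 2))\<^sup>2" .
    qed simp
    finally show ?thesis by (simp add: ennreal_leI)
  qed
  have "emeasure ?S ?T = (\<integral>\<^sup>+z. indicator ?T z \<partial>?S)"
    by (rule nn_integral_indicator[symmetric]) measurable
  also have "\<dots> \<le> (\<integral>\<^sup>+z. ennreal (exp (- 2 * x)) * (\<Prod>i<n. ennreal (exp (u i * (z i)\<^sup>2 / 4))) \<partial>?S)"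
  proof (rule nn_integral_mono)
    fix z assume "z \<in> space ?S"
    have "ennreal (exp (- 2 * x)) * (\<Prod>i<n. ennreal (exp (u i * (z i)\<^sup>2 / 4)))
        = ennreal (exp (- 2 * x + (\<Sum>i<n. u i * (z i)\<^sup>2) / 4))"
      unfolding exp_add sum_divide_distrib exp_sum[OF finite_lessThan]
      by (simp add: prod_ennreal ennreal_mult prod_nonneg)
    moreover have "0 \<le> - 2 * x + (\<Sum>i<n. u i * (z i)\<^sup>2) / 4" if "z \<in> ?T"
      using that by (simp add: x_def)
    ultimately show "indicator ?T z \<le> ennreal (exp (- 2 * x)) * (\<Prod>i<n. ennreal (exp (u i * (z i)\<^sup>2 / 4)))"
      by (auto simp: indicator_def)
  qed
  also have "\<dots> = ennreal (exp (- 2 * x)) * (\<Prod>i<n. \<integral>\<^sup>+z. ennreal (exp (u i * z\<^sup>2 / 4)) \<partial>std_normal_distribution)"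
    by (subst nn_integral_cmult, simp, subst S.product_nn_integral_prod) simp_all
  also have "\<dots> \<le> ennreal (exp (- 2 * x)) * (\<Prod>i<n. ennreal (exp (u i / 2)))"
    by (intro mult_left_mono prod_mono_ennreal mgf) auto
  also have "\<dots> = ennreal (exp (- (3 / 2) * x))"
    by (simp add: prod_ennreal exp_sum[symmetric] sum_divide_distrib[symmetric] x_def[symmetric] flip: ennreal_mult exp_add)
  finally show ?thesis by (simp add: x_def)
qed

section \<open>Small ball probabilities under a Gaussian posterior\<close>

lemma sum_square_orthogonal_columns:
  fixes R :: "'j \<Rightarrow> nat \<Rightarrow> real"
  assumes "\<And>i k. i < n \<Longrightarrow> k < n \<Longrightarrow> i \<noteq> k \<Longrightarrow> (\<Sum>j\<in>J. R j i * R j k) = 0"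
  shows "(\<Sum>j\<in>J. (\<Sum>i<n. R j i * x i)\<^sup>2) = (\<Sum>i<n. (\<Sum>j\<in>J. (R j i)\<^sup>2) * (x i)\<^sup>2)"
proof -
  have "(\<Sum>j\<in>J. (\<Sum>i<n. R j i * x i)\<^sup>2) = (\<Sum>j\<in>J. \<Sum>i<n. \<Sum>k<n. (R j i * R j k) * (x i * x k))"
    by (simp add: power2_eq_square sum_product mult_ac)
  also have "\<dots> = (\<Sum>i<n. \<Sum>k<n. (\<Sum>j\<in>J. R j i * R j k) * (x i * x k))"
    by (subst sum.swap, rule sum.cong[OF refl], subst sum.swap) (simp add: sum_distrib_right)
  also have "\<dots> = (\<Sum>i<n. \<Sum>k<n. if k = i then (\<Sum>j\<in>J. (R j i)\<^sup>2) * (x i)\<^sup>2 else 0)"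
    by (intro sum.cong refl) (auto simp: assms power2_eq_square)
  finally show ?thesis by simp
qed

text \<open>
  Here \<open>z\<close> are standard Gaussian coordinates of the parameter \<open>(s i * z i)\<close>, the observation is
  \<open>R z + e\<close>, and \<open>a\<close> is an arbitrary estimator.  Exchanging the order of integration, one integrates
  over \<open>z\<close> for a fixed observation \<open>w\<close>.  As the columns of \<open>R\<close> are orthogonal, prior times
  likelihood is a product of functions \<open>exp (c\<^sub>i z\<^sub>i - (1 + D\<^sub>i) z\<^sub>i\<^sup>2 / 2)\<close> up to a factor depending on
  \<open>w\<close> only, and the one-dimensional bound applies to each coordinate, uniformly in \<open>w\<close> and \<open>a\<close>.
\<close>
lemma gaussian_posterior_small_ball:
  fixes R :: "'j \<Rightarrow> nat \<Rightarrow> real" and s :: "nat \<Rightarrow> real" and a :: "nat \<Rightarrow> ('j \<Rightarrow> real) \<Rightarrow> real"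
  assumes J: "finite J" and lam: "0 < lam" and s: "\<And>i. i < n \<Longrightarrow> 0 < s i"
    and orth: "\<And>i k. i < n \<Longrightarrow> k < n \<Longrightarrow> i \<noteq> k \<Longrightarrow> (\<Sum>j\<in>J. R j i * R j k) = 0"
    and a[measurable]: "\<And>i. i < n \<Longrightarrow> a i \<in> borel_measurable (\<Pi>\<^sub>M j\<in>J. (borel :: real measure))"
  defines "D \<equiv> \<lambda>i. \<Sum>j\<in>J. (R j i)\<^sup>2"
  shows "(\<integral>\<^sup>+z. (\<integral>\<^sup>+e. ennreal (exp (- (lam / 2) *
            (\<Sum>i<n. (a i (\<lambda>j\<in>J. (\<Sum>i<n. R j i * z i) + e j) - s i * z i)\<^sup>2)))
          \<partial>(\<Pi>\<^sub>M j\<in>J. std_normal_distribution)) \<partial>(\<Pi>\<^sub>M i\<in>{..<n}. std_normal_distribution))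
    \<le> ennreal (\<Prod>i<n. sqrt ((1 + D i) / (1 + D i + lam * (s i)\<^sup>2)))"
    (is "?lhs \<le> ennreal ?rho")
proof -
  let ?SJ = "\<Pi>\<^sub>M j\<in>J. std_normal_distribution" and ?LJ = "\<Pi>\<^sub>M j\<in>J. (lborel :: real measure)"
  let ?Sn = "\<Pi>\<^sub>M i\<in>{..<n}. std_normal_distribution" and ?Ln = "\<Pi>\<^sub>M i\<in>{..<n}. (lborel :: real measure)"
  let ?BJ = "\<Pi>\<^sub>M j\<in>J. (borel :: real measure)" and ?Bn = "\<Pi>\<^sub>M i\<in>{..<n}. (borel :: real measure)"
  interpret L: product_sigma_finite "\<lambda>_. lborel :: real measure" by standard
  interpret LJ: sigma_finite_measure ?LJ by (rule L.sigma_finite[OF J])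
  interpret Ln: sigma_finite_measure ?Ln by (rule L.sigma_finite) simp
  interpret P: pair_sigma_finite ?Ln ?LJ by standard
  have normal: "prob_space std_normal_distribution"
    by (rule real_distribution.axioms(1)[OF real_dist_normal_dist])
  interpret SJ: prob_space ?SJ by (rule prob_space_PiM) (rule normal)
  interpret Sn: prob_space ?Sn by (rule prob_space_PiM) (rule normal)
  define lik where "lik z w = (\<Prod>j\<in>J. ennreal (std_normal_density (w j - (\<Sum>i<n. R j i * z i))))" for z w
  define pri where "pri z = (\<Prod>i<n. ennreal (std_normal_density (z i)))" for z
  define loss where "loss z w = ennreal (exp (- (lam / 2) * (\<Sum>i<n. (a i w - s i * z i)\<^sup>2)))" for z w
  have sets_LB[measurable_cong]: "sets ?LJ = sets ?BJ" "sets ?Ln = sets ?Bn"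
    by (intro sets_PiM_cong; simp)+
  have [measurable]: "(\<lambda>(z, w). lik z w) \<in> borel_measurable (?Bn \<Otimes>\<^sub>M ?BJ)"
    unfolding lik_def by measurable
  have [measurable]: "pri \<in> borel_measurable ?Bn"
    unfolding pri_def by measurable
  have [measurable]: "(\<lambda>(z, w). loss z w) \<in> borel_measurable (?Bn \<Otimes>\<^sub>M ?BJ)"
    unfolding loss_def by measurable
  have prior_int: "(\<integral>\<^sup>+z. h z \<partial>?Sn) = (\<integral>\<^sup>+z. pri z * h z \<partial>?Ln)" if h[measurable]: "h \<in> borel_measurable ?Bn" for h
  proof -
    have "(\<integral>\<^sup>+z. h z \<partial>?Sn) = (\<integral>\<^sup>+z. h (\<lambda>i\<in>{..<n}. 0 + z i) \<partial>?Sn)"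
    proof (rule nn_integral_cong)
      fix z assume "z \<in> space ?Sn"
      then have "z \<in> extensional {..<n}" by (auto simp: space_PiM PiE_iff)
      then have "(\<lambda>i\<in>{..<n}. 0 + z i) = z" by (auto simp: extensional_def restrict_def)
      then show "h z = h (\<lambda>i\<in>{..<n}. 0 + z i)" by simp
    qed
    then show ?thesis
      using nn_integral_gaussian_shift[of "{..<n}" h "\<lambda>_. 0"] by (simp add: pri_def)
  qed
  have lik_int: "(\<integral>\<^sup>+e. h (\<lambda>j\<in>J. (\<Sum>i<n. R j i * z i) + e j) \<partial>?SJ) = (\<integral>\<^sup>+w. lik z w * h w \<partial>?LJ)"
    if "h \<in> borel_measurable ?BJ" for h z
    unfolding lik_def by (rule nn_integral_gaussian_shift[OF J that])
  have lik_mass: "(\<integral>\<^sup>+w. lik z w \<partial>?LJ) = 1" for z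
    using lik_int[of "\<lambda>_. 1" z] SJ.emeasure_space_1 by simp
  have pri_mass: "(\<integral>\<^sup>+z. pri z \<partial>?Ln) = 1"
    using prior_int[of "\<lambda>_. 1"] Sn.emeasure_space_1 by simp
  have posterior: "(\<integral>\<^sup>+z. pri z * (lik z w * loss z w) \<partial>?Ln) \<le> ennreal ?rho * (\<integral>\<^sup>+z. pri z * lik z w \<partial>?Ln)" for w
  proof -
    define c where "c i = (\<Sum>j\<in>J. R j i * w j)" for i
    define K where "K = (\<Prod>i<n. 1 / sqrt (2 * pi)) * (\<Prod>j\<in>J. 1 / sqrt (2 * pi) * exp (- (w j)\<^sup>2 / 2))"
    have K: "0 \<le> K" unfolding K_def by (intro mult_nonneg_nonneg prod_nonneg) auto
    define f where "f i x = exp (c i * x - (1 + D i) * x\<^sup>2 / 2)" for i x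
    define g where "g i x = exp (- (lam * (s i)\<^sup>2 * (a i w / s i - x)\<^sup>2) / 2)" for i x
    have joint: "pri z * lik z w = ennreal K * (\<Prod>i<n. ennreal (f i (z i)))" for z
    proof -
      have "(\<Sum>j\<in>J. (w j - (\<Sum>i<n. R j i * z i))\<^sup>2)
          = (\<Sum>j\<in>J. (w j)\<^sup>2) - 2 * (\<Sum>j\<in>J. w j * (\<Sum>i<n. R j i * z i)) + (\<Sum>j\<in>J. (\<Sum>i<n. R j i * z i)\<^sup>2)"
        by (simp add: power2_diff sum.distrib sum_subtractf sum_distrib_left mult.assoc)
      also have "(\<Sum>j\<in>J. w j * (\<Sum>i<n. R j i * z i)) = (\<Sum>i<n. c i * z i)"
        unfolding c_def sum_distrib_left sum_distrib_right by (subst sum.swap) (simp add: mult_ac)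
      also have "(\<Sum>j\<in>J. (\<Sum>i<n. R j i * z i)\<^sup>2) = (\<Sum>i<n. D i * (z i)\<^sup>2)"
        unfolding D_def by (rule sum_square_orthogonal_columns[OF orth])
      finally have quad: "(\<Sum>i<n. - (z i)\<^sup>2 / 2) + (\<Sum>j\<in>J. - (w j - (\<Sum>i<n. R j i * z i))\<^sup>2 / 2)
          = (\<Sum>j\<in>J. - (w j)\<^sup>2 / 2) + (\<Sum>i<n. c i * z i - (1 + D i) * (z i)\<^sup>2 / 2)"
        by (simp add: sum.distrib sum_subtractf sum_negf sum_divide_distrib[symmetric] ring_distribs add_divide_distrib diff_divide_distrib)
      have "pri z * lik z w = ennreal ((\<Prod>i<n. std_normal_density (z i)) *
          (\<Prod>j\<in>J. std_normal_density (w j - (\<Sum>i<n. R j i * z i))))"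
        unfolding pri_def lik_def by (simp add: prod_ennreal ennreal_mult prod_nonneg)
      also have "(\<Prod>i<n. std_normal_density (z i)) * (\<Prod>j\<in>J. std_normal_density (w j - (\<Sum>i<n. R j i * z i)))
          = (\<Prod>i<n. 1 / sqrt (2 * pi)) * (\<Prod>j\<in>J. 1 / sqrt (2 * pi)) *
            exp ((\<Sum>i<n. - (z i)\<^sup>2 / 2) + (\<Sum>j\<in>J. - (w j - (\<Sum>i<n. R j i * z i))\<^sup>2 / 2))"
        unfolding std_normal_density_def prod.distrib exp_add exp_sum[OF finite_lessThan] exp_sum[OF J] by (simp only: mult_ac)
      also have "\<dots> = K * (\<Prod>i<n. f i (z i))"
        unfolding quad exp_add f_def K_def prod.distrib exp_sum[OF finite_lessThan] exp_sum[OF J] by (simp only: mult_ac)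
      finally show ?thesis using K by (simp add: prod_ennreal ennreal_mult prod_nonneg f_def)
    qed
    have loss_eq: "loss z w = (\<Prod>i<n. ennreal (g i (z i)))" for z
    proof -
      have "- (lam / 2) * (\<Sum>i<n. (a i w - s i * z i)\<^sup>2) = (\<Sum>i<n. - (lam * (s i)\<^sup>2 * (a i w / s i - z i)\<^sup>2) / 2)"
        unfolding sum_distrib_left
      proof (intro sum.cong refl)
        fix i assume "i \<in> {..<n}"
        then have "a i w - s i * z i = s i * (a i w / s i - z i)" using s[of i] by (simp add: field_simps)
        then show "- (lam / 2) * (a i w - s i * z i)\<^sup>2 = - (lam * (s i)\<^sup>2 * (a i w / s i - z i)\<^sup>2) / 2"
          by (simp add: power_mult_distrib)
      qed
      then show ?thesis
        unfolding loss_def g_def by (simp only: exp_sum[OF finite_lessThan] prod_ennreal exp_ge_zero)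
    qed
    have "(\<integral>\<^sup>+z. pri z * (lik z w * loss z w) \<partial>?Ln)
        = (\<integral>\<^sup>+z. ennreal K * (\<Prod>i<n. ennreal (f i (z i) * g i (z i))) \<partial>?Ln)"
      by (intro nn_integral_cong)
         (simp add: mult.assoc[symmetric] joint loss_eq, simp add: mult.assoc prod.distrib[symmetric] ennreal_mult f_def g_def)
    also have "\<dots> = ennreal K * (\<Prod>i<n. \<integral>\<^sup>+x. ennreal (f i x * g i x) \<partial>lborel)"
      by (subst nn_integral_cmult, (simp add: f_def g_def), subst L.product_nn_integral_prod)
        (simp_all add: f_def g_def)
    also have "\<dots> \<le> ennreal K * (\<Prod>i<n. ennreal (sqrt ((1 + D i) / (1 + D i + lam * (s i)\<^sup>2))) * (\<integral>\<^sup>+x. ennreal (f i x) \<partial>lborel))"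
    proof (intro mult_left_mono prod_mono_ennreal)
      fix i assume i: "i \<in> {..<n}"
      have "0 \<le> D i" unfolding D_def by (intro sum_nonneg) simp
      then show "(\<integral>\<^sup>+x. ennreal (f i x * g i x) \<partial>lborel)
          \<le> ennreal (sqrt ((1 + D i) / (1 + D i + lam * (s i)\<^sup>2))) * (\<integral>\<^sup>+x. ennreal (f i x) \<partial>lborel)"
        unfolding f_def g_def using lam s[of i] i by (intro gaussian_small_ball_1d) auto
    qed auto
    also have "\<dots> = (\<Prod>i<n. ennreal (sqrt ((1 + D i) / (1 + D i + lam * (s i)\<^sup>2)))) *
        (ennreal K * (\<Prod>i<n. \<integral>\<^sup>+x. ennreal (f i x) \<partial>lborel))"
      by (simp add: prod.distrib mult_ac)
    also have "(\<Prod>i<n. ennreal (sqrt ((1 + D i) / (1 + D i + lam * (s i)\<^sup>2)))) = ennreal ?rho"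
      using lam by (intro prod_ennreal) (auto simp: D_def intro!: divide_nonneg_nonneg add_nonneg_nonneg sum_nonneg)
    also have "ennreal K * (\<Prod>i<n. \<integral>\<^sup>+x. ennreal (f i x) \<partial>lborel) = (\<integral>\<^sup>+z. pri z * lik z w \<partial>?Ln)"
      unfolding joint
      by (subst nn_integral_cmult, (simp add: f_def), subst L.product_nn_integral_prod)
        (simp_all add: f_def)
    finally show ?thesis .
  qed
  have lik_w[measurable]: "lik z \<in> borel_measurable ?BJ" for z
    unfolding lik_def by measurable
  have loss_w[measurable]: "loss z \<in> borel_measurable ?BJ" for z
    unfolding loss_def by measurable
  have "?lhs = (\<integral>\<^sup>+z. (\<integral>\<^sup>+w. lik z w * loss z w \<partial>?LJ) \<partial>?Sn)"
    by (simp only: lik_int[OF loss_w, symmetric]) (simp only: loss_def)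
  also have "\<dots> = (\<integral>\<^sup>+z. pri z * (\<integral>\<^sup>+w. lik z w * loss z w \<partial>?LJ) \<partial>?Ln)"
    by (rule prior_int) measurable
  also have "\<dots> = (\<integral>\<^sup>+z. (\<integral>\<^sup>+w. pri z * (lik z w * loss z w) \<partial>?LJ) \<partial>?Ln)"
    by (intro nn_integral_cong nn_integral_cmult[symmetric]) measurable
  also have "\<dots> = (\<integral>\<^sup>+w. (\<integral>\<^sup>+z. pri z * (lik z w * loss z w) \<partial>?Ln) \<partial>?LJ)"
    by (rule P.Fubini'[symmetric]) measurable
  also have "\<dots> \<le> (\<integral>\<^sup>+w. ennreal ?rho * (\<integral>\<^sup>+z. pri z * lik z w \<partial>?Ln) \<partial>?LJ)"
    by (intro nn_integral_mono posterior)
  also have "\<dots> = ennreal ?rho * (\<integral>\<^sup>+w. (\<integral>\<^sup>+z. pri z * lik z w \<partial>?Ln) \<partial>?LJ)"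
    by (rule nn_integral_cmult) measurable
  also have "(\<integral>\<^sup>+w. (\<integral>\<^sup>+z. pri z * lik z w \<partial>?Ln) \<partial>?LJ) = (\<integral>\<^sup>+z. (\<integral>\<^sup>+w. pri z * lik z w \<partial>?LJ) \<partial>?Ln)"
    by (rule P.Fubini') measurable
  also have "\<dots> = (\<integral>\<^sup>+z. pri z * (\<integral>\<^sup>+w. lik z w \<partial>?LJ) \<partial>?Ln)"
    by (intro nn_integral_cong nn_integral_cmult) measurable
  also have "\<dots> = 1" by (simp add: lik_mass pri_mass)
  finally show ?thesis by (simp only: mult_1_right)
qed

text \<open>
  Convexity of the exponential function: its graph lies below the chord over the segment from \<open>0\<close>
  to \<open>a\<close>.
\<close>
lemma exp_le_linear_interpolation:
  fixes a p :: real
  assumes "0 \<le> p" "p \<le> 1"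
  shows "exp (a * p) \<le> 1 + (exp a - 1) * p"
proof -
  have "exp ((1 - p) *\<^sub>R 0 + p *\<^sub>R a) \<le> (1 - p) * exp 0 + p * exp a"
    using assms by (intro convex_onD[OF exp_convex]) auto
  then show ?thesis by (simp add: algebra_simps)
qed

text \<open>
  Markov's inequality for the exponential loss with parameter \<open>lam = 9 t / b\<close>, \<open>t = exp (5 C) - 1\<close>.
  The radius is chosen so that the exponential prefactor is \<open>exp x\<close> with \<open>x = \<Sum>u\<^sub>i\<close>.  Each factor of
  the posterior bound is at most \<open>(1 + t u\<^sub>i\<^sup>2) powr (- 1/2) \<le> exp (- 5 C u\<^sub>i\<^sup>2 / 2)\<close>, and
  \<open>C \<Sum>u\<^sub>i\<^sup>2 \<ge> x\<close> turns their product into \<open>exp (- 5 x / 2)\<close>.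
\<close>
lemma gaussian_bayes_small_ball_probability:
  fixes R :: "'j \<Rightarrow> nat \<Rightarrow> real" and u :: "nat \<Rightarrow> real" and a :: "nat \<Rightarrow> ('j \<Rightarrow> real) \<Rightarrow> real"
  assumes J: "finite J" and b: "0 < b" and u: "\<And>i. i < n \<Longrightarrow> 0 < u i \<and> u i \<le> 1"
    and C: "1 \<le> C" and uC: "(\<Sum>i<n. u i) \<le> C * (\<Sum>i<n. (u i)\<^sup>2)"
    and orth: "\<And>i k. i < n \<Longrightarrow> k < n \<Longrightarrow> i \<noteq> k \<Longrightarrow> (\<Sum>j\<in>J. R j i * R j k) = 0"
    and diag: "\<And>i. i < n \<Longrightarrow> (\<Sum>j\<in>J. (R j i)\<^sup>2) = u i / 8"
    and a[measurable]: "\<And>i. i < n \<Longrightarrow> a i \<in> borel_measurable (\<Pi>\<^sub>M j\<in>J. (borel :: real measure))"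
  shows "(\<integral>\<^sup>+z. emeasure (\<Pi>\<^sub>M j\<in>J. std_normal_distribution)
            {e \<in> space (\<Pi>\<^sub>M j\<in>J. std_normal_distribution).
              (\<Sum>i<n. (a i (\<lambda>j\<in>J. (\<Sum>i<n. R j i * z i) + e j) - u i * sqrt (b / 8) * z i)\<^sup>2)
                \<le> 2 / (9 * (exp (5 * C) - 1)) * (b * (\<Sum>i<n. u i))}
          \<partial>(\<Pi>\<^sub>M i\<in>{..<n}. std_normal_distribution))
    \<le> ennreal (exp (- (3 / 2) * (\<Sum>i<n. u i)))"
    (is "(\<integral>\<^sup>+z. emeasure ?SJ (?T z) \<partial>?Sn) \<le> _")
proof -
  define x where "x = (\<Sum>i<n. u i)"
  define t where "t = exp (5 * C) - 1"
  define lam where "lam = 9 * t / b"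
  define s where "s i = u i * sqrt (b / 8)" for i
  define loss where "loss z e = (\<Sum>i<n. (a i (\<lambda>j\<in>J. (\<Sum>i<n. R j i * z i) + e j) - s i * z i)\<^sup>2)" for z e
  define h where "h z e = ennreal (exp (- (lam / 2) * loss z e))" for z e
  have t: "0 < t" using C by (simp add: t_def)
  have lam: "0 < lam" using t b by (simp add: lam_def)
  have s: "0 < s i" if "i < n" for i using u[OF that] b by (simp add: s_def)
  have r: "2 / (9 * (exp (5 * C) - 1)) * (b * x) = 2 * x / lam" using b by (simp add: lam_def t_def)
  have T: "?T z = {e \<in> space ?SJ. loss z e \<le> 2 * x / lam}" for z
    unfolding loss_def s_def x_def[symmetric] r ..
  interpret SJ: prob_space ?SJ
    by (rule prob_space_PiM) (rule real_distribution.axioms(1)[OF real_dist_normal_dist])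
  have sets_SB[measurable_cong]: "sets ?SJ = sets (\<Pi>\<^sub>M j\<in>J. (borel :: real measure))"
    "sets ?Sn = sets (\<Pi>\<^sub>M i\<in>{..<n}. (borel :: real measure))"
    by (intro sets_PiM_cong; simp)+
  have loss_pair[measurable]: "(\<lambda>(z, e). loss z e) \<in> borel_measurable (?Sn \<Otimes>\<^sub>M ?SJ)"
    unfolding loss_def by measurable
  have loss_m[measurable]: "loss z \<in> borel_measurable ?SJ" for z
    unfolding loss_def by measurable
  have h_pair[measurable]: "(\<lambda>(z, e). h z e) \<in> borel_measurable (?Sn \<Otimes>\<^sub>M ?SJ)"
    unfolding h_def by measurable
  have h_m[measurable]: "h z \<in> borel_measurable ?SJ" for z
    unfolding h_def by measurable
  have markov: "emeasure ?SJ (?T z) \<le> ennreal (exp x) * (\<integral>\<^sup>+e. h z e \<partial>?SJ)" for z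
  proof -
    have "emeasure ?SJ (?T z) = (\<integral>\<^sup>+e. indicator (?T z) e \<partial>?SJ)"
      unfolding T by (rule nn_integral_indicator[symmetric]) measurable
    also have "\<dots> \<le> (\<integral>\<^sup>+e. ennreal (exp x) * h z e \<partial>?SJ)"
    proof (rule nn_integral_mono)
      fix e
      have "0 \<le> x + - (lam / 2) * loss z e" if "e \<in> ?T z"
        using that lam unfolding T by (simp add: field_simps)
      then show "indicator (?T z) e \<le> ennreal (exp x) * h z e"
        unfolding h_def by (auto simp: indicator_def simp flip: ennreal_mult exp_add)
    qed
    also have "\<dots> = ennreal (exp x) * (\<integral>\<^sup>+e. h z e \<partial>?SJ)"
      by (rule nn_integral_cmult) measurable
    finally show ?thesis .
  qed
  have "(\<Prod>i<n. sqrt ((1 + (\<Sum>j\<in>J. (R j i)\<^sup>2)) / (1 + (\<Sum>j\<in>J. (R j i)\<^sup>2) + lam * (s i)\<^sup>2)))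
      \<le> (\<Prod>i<n. exp (- (5 * C * (u i)\<^sup>2) / 2))"
  proof (rule prod_mono)
    fix i assume "i \<in> {..<n}"
    then have i: "i < n" by simp
    let ?p = "(u i)\<^sup>2"
    have p: "0 \<le> ?p" "?p \<le> 1" using u[OF i] by (auto simp: power_le_one)
    \<comment> \<open>\<open>lam\<close> carries the factor \<open>9\<close> because the posterior precision \<open>1 + u i / 8\<close> is at most \<open>9/8\<close>.\<close>
    have lams: "lam * (s i)\<^sup>2 = 9 / 8 * (t * ?p)"
      using b by (simp add: lam_def s_def power_mult_distrib)
    have tp: "0 \<le> t * ?p" using t by simp
    have "1 + t * ?p \<le> (1 + u i / 8 + 9 / 8 * (t * ?p)) / (1 + u i / 8)"
    proof -
      have "(1 + t * ?p) * (1 + u i / 8) = 1 + u i / 8 + t * ?p * (1 + u i / 8)" by (simp add: algebra_simps)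
      also have "t * ?p * (1 + u i / 8) \<le> t * ?p * (9 / 8)"
        using u[OF i] tp by (intro mult_left_mono) auto
      finally show ?thesis using u[OF i] by (simp add: field_simps)
    qed
    moreover have "exp (5 * C * ?p) \<le> 1 + t * ?p"
      unfolding t_def by (rule exp_le_linear_interpolation) (use p in auto)
    ultimately have "exp (5 * C * ?p) \<le> (1 + u i / 8 + 9 / 8 * (t * ?p)) / (1 + u i / 8)" by linarith
    then have "inverse ((1 + u i / 8 + 9 / 8 * (t * ?p)) / (1 + u i / 8)) \<le> inverse (exp (5 * C * ?p))"
      by (rule le_imp_inverse_le) simp
    then have "(1 + u i / 8) / (1 + u i / 8 + 9 / 8 * (t * ?p)) \<le> exp (- (5 * C * ?p))"
      by (simp add: exp_minus)
    also have "\<dots> = (exp (- (5 * C * ?p) / 2))\<^sup>2" by (simp add: power2_eq_square flip: exp_add)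
    finally have "sqrt ((1 + u i / 8) / (1 + u i / 8 + 9 / 8 * (t * ?p))) \<le> exp (- (5 * C * ?p) / 2)"
      by (intro real_le_lsqrt) auto
    then show "0 \<le> sqrt ((1 + (\<Sum>j\<in>J. (R j i)\<^sup>2)) / (1 + (\<Sum>j\<in>J. (R j i)\<^sup>2) + lam * (s i)\<^sup>2)) \<and>
        sqrt ((1 + (\<Sum>j\<in>J. (R j i)\<^sup>2)) / (1 + (\<Sum>j\<in>J. (R j i)\<^sup>2) + lam * (s i)\<^sup>2)) \<le> exp (- (5 * C * ?p) / 2)"
      unfolding diag[OF i] lams using u[OF i] tp by auto
  qed
  also have "(\<Prod>i<n. exp (- (5 * C * (u i)\<^sup>2) / 2)) = exp (- (5 / 2) * (C * (\<Sum>i<n. (u i)\<^sup>2)))"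
    by (simp add: exp_sum[symmetric] sum_distrib_left sum_negf mult_ac)
  also have "\<dots> \<le> exp (- (5 / 2) * x)"
    using uC by (simp add: x_def)
  finally have rho: "(\<Prod>i<n. sqrt ((1 + (\<Sum>j\<in>J. (R j i)\<^sup>2)) / (1 + (\<Sum>j\<in>J. (R j i)\<^sup>2) + lam * (s i)\<^sup>2)))
      \<le> exp (- (5 / 2) * x)" .
  have "(\<integral>\<^sup>+z. emeasure ?SJ (?T z) \<partial>?Sn) \<le> (\<integral>\<^sup>+z. ennreal (exp x) * (\<integral>\<^sup>+e. h z e \<partial>?SJ) \<partial>?Sn)"
    by (intro nn_integral_mono markov)
  also have "\<dots> = ennreal (exp x) * (\<integral>\<^sup>+z. (\<integral>\<^sup>+e. h z e \<partial>?SJ) \<partial>?Sn)"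
    by (rule nn_integral_cmult) measurable
  also have "\<dots> \<le> ennreal (exp x) * ennreal (\<Prod>i<n. sqrt ((1 + (\<Sum>j\<in>J. (R j i)\<^sup>2)) / (1 + (\<Sum>j\<in>J. (R j i)\<^sup>2) + lam * (s i)\<^sup>2)))"
    unfolding h_def loss_def
    by (intro mult_left_mono gaussian_posterior_small_ball J lam s orth a) auto
  also have "\<dots> \<le> ennreal (exp x) * ennreal (exp (- (5 / 2) * x))"
    by (intro mult_left_mono ennreal_leI rho) simp
  also have "\<dots> = ennreal (exp (- (3 / 2) * x))"
    by (simp flip: ennreal_mult exp_add)
  finally show ?thesis by (simp only: x_def)
qed

section \<open>From the Bayes bound to the minimax bound\<close>

text \<open>
  The noise space may be enlarged to \<open>N \<ge> m\<close> coordinates; the surplus ones carry the noise of the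
  additional observation.
\<close>
lemma obs_law_eq_distr:
  assumes A: "A \<in> carrier_mat m n" and N: "m \<le> N"
  shows "obs_law A \<sigma> f = distr (\<Pi>\<^sub>M j\<in>{..<N}. std_normal_distribution) (vec_borel m)
    (\<lambda>e. Matrix.vec m (\<lambda>j. vec_index (A *\<^sub>v f) j + \<sigma> * e j))"
proof -
  let ?Sm = "\<Pi>\<^sub>M j\<in>{..<m}. std_normal_distribution" and ?SN = "\<Pi>\<^sub>M j\<in>{..<N}. std_normal_distribution"
  interpret S: product_prob_space "\<lambda>_. std_normal_distribution" "{..<N}"
    by (rule product_prob_spaceI) (rule real_distribution.axioms(1)[OF real_dist_normal_dist])
  have dim: "dim_row A = m" using A by simp
  have coord: "(\<lambda>x. x i) \<in> borel_measurable ?Sm" if "i < m" for i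
    using measurable_component_singleton[of i "{..<m}" "\<lambda>_. std_normal_distribution"] that by simp
  have vec_m: "Matrix.vec m \<in> measurable ?Sm (vec_borel m)"
    by (rule measurable_vec_borelI) (use coord in auto)
  have shift_m: "(\<lambda>e. A *\<^sub>v f + \<sigma> \<cdot>\<^sub>v e) \<in> measurable (vec_borel m) (vec_borel m)"
  proof (rule measurable_vec_borelI)
    fix i assume i: "i < m"
    have "(\<lambda>e. vec_index (A *\<^sub>v f) i + \<sigma> * vec_index e i) \<in> borel_measurable (vec_borel m)"
      using measurable_vec_index[OF i] by measurable
    then show "(\<lambda>e. vec_index (A *\<^sub>v f + \<sigma> \<cdot>\<^sub>v e) i) \<in> borel_measurable (vec_borel m)"
      by (rule measurable_cong[THEN iffD2, rotated]) (use i dim in auto)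
  next
    fix e assume "e \<in> space (vec_borel m)"
    then have "dim_vec (A *\<^sub>v f + \<sigma> \<cdot>\<^sub>v e) = m" by simp
    then show "A *\<^sub>v f + \<sigma> \<cdot>\<^sub>v e \<in> carrier_vec m" by (rule carrier_vecI)
  qed
  have restr_m: "(\<lambda>e. restrict e {..<m}) \<in> measurable ?SN ?Sm"
    by (rule measurable_restrict_subset) (use N in auto)
  have "obs_law A \<sigma> f = distr ?Sm (vec_borel m) ((\<lambda>e. A *\<^sub>v f + \<sigma> \<cdot>\<^sub>v e) \<circ> Matrix.vec m)"
    unfolding obs_law_def std_gaussian_def dim by (rule distr_distr[OF shift_m vec_m])
  also have "?Sm = distr ?SN ?Sm (\<lambda>e. restrict e {..<m})"
    by (rule S.distr_restrict) (use N in auto)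
  also have "distr \<dots> (vec_borel m) ((\<lambda>e. A *\<^sub>v f + \<sigma> \<cdot>\<^sub>v e) \<circ> Matrix.vec m)
      = distr ?SN (vec_borel m) (((\<lambda>e. A *\<^sub>v f + \<sigma> \<cdot>\<^sub>v e) \<circ> Matrix.vec m) \<circ> (\<lambda>e. restrict e {..<m}))"
    by (rule distr_distr[OF measurable_comp[OF vec_m shift_m] restr_m])
  also have "\<dots> = distr ?SN (vec_borel m) (\<lambda>e. Matrix.vec m (\<lambda>j. vec_index (A *\<^sub>v f) j + \<sigma> * e j))"
  proof (intro distr_cong refl)
    fix e assume "e \<in> space ?SN"
    show "(((\<lambda>e. A *\<^sub>v f + \<sigma> \<cdot>\<^sub>v e) \<circ> Matrix.vec m) \<circ> (\<lambda>e. restrict e {..<m})) e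
        = Matrix.vec m (\<lambda>j. vec_index (A *\<^sub>v f) j + \<sigma> * e j)"
      using dim by (intro eq_vecI) auto
  qed
  finally show ?thesis .
qed

text \<open>
  With \<open>S\<close> the supremum, every prior draw in the ellipsoid has a loss within the radius with
  probability at least \<open>1 - S\<close>.  Averaging over the prior gives
  \<open>(1 - S) (1 - \<epsilon>) \<le> \<epsilon>\<close> with \<open>\<epsilon> = exp (- 3 M \<mu> / 2)\<close>, where one \<open>\<epsilon>\<close> bounds the mass outside the
  ellipsoid and the other one the Bayes small ball probability; hence \<open>1 - S \<le> 2 \<epsilon>\<close>.
\<close>
lemma minimax_lower_bound_ellipsoid:
  assumes n: "1 \<le> n" and A: "A \<in> carrier_mat m n" and sigma: "0 < \<sigma>" and G: "G \<in> carrier_mat n n"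
    and G_sym: "transpose_mat G = G" and mu: "0 < \<mu>" and M: "0 \<le> M" and Finv: "Finv \<in> carrier_mat n n"
    and inv: "Fisher_pen A \<sigma> (G * G) \<mu> * Finv = 1\<^sub>m n" "Finv * Fisher_pen A \<sigma> (G * G) \<mu> = 1\<^sub>m n"
    and balance: "M * \<mu> * op_norm Finv = mat_trace Finv" and C: "1 \<le> C" "C0 \<le> C"
    and trace: "mat_trace Finv / op_norm Finv \<le> C0 * (mat_trace (Finv * Finv) / op_norm (Finv * Finv))"
    and fhat: "fhat \<in> estimators m n"
  shows "1 \<le> M * \<mu>"
    and "1 - 2 * exp (- (3 / 2) * (M * \<mu>)) \<le> (SUP f\<in>ellipsoid G M.
      \<P>(y in obs_law A \<sigma> f. (vec_norm2 (fhat y - f))\<^sup>2 > 2 / (9 * (exp (5 * C) - 1)) * mat_trace Finv))"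
proof -
  define r where "r U j k = (if j < m then (A * U) $$ (j, k) / \<sigma> else sqrt \<mu> * (G * U) $$ (j - m, k))" for U j k
  have "\<exists>U beta. real_orthogonal_mat n U \<and> (\<forall>k<n. 0 < beta k) \<and> Finv = spectral_mat n U beta \<and>
    (\<forall>i<n. \<forall>k<n. (\<Sum>j<m + n. r U j i * r U j k) = (if i = k then 1 / beta i else 0))"
    unfolding r_def using mu by (intro penalized_fisher_diagonalization A sigma G G_sym Finv inv) simp
  then obtain U beta where U: "real_orthogonal_mat n U" and beta: "\<And>k. k < n \<Longrightarrow> 0 < beta k"
      and Finv_eq: "Finv = spectral_mat n U beta"
      and gram: "\<And>i k. i < n \<Longrightarrow> k < n \<Longrightarrow> (\<Sum>j<m + n. r U j i * r U j k) = (if i = k then 1 / beta i else 0)"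
    by blast
  have Uc: "U \<in> carrier_mat n n" using U by (simp add: real_orthogonal_mat_def)
  define b where "b = Max (beta ` {..<n})"
  have "b \<in> beta ` {..<n}" unfolding b_def using n by (intro Max_in) (auto simp: lessThan_empty_iff)
  then obtain k0 where k0: "k0 < n" "b = beta k0" by auto
  have le_b: "beta k \<le> b" if "k < n" for k unfolding b_def using that by (intro Max_ge) auto
  have b: "0 < b" using k0 beta by simp
  define u where "u k = beta k / b" for k
  define x where "x = (\<Sum>k<n. u k)"
  have u: "0 < u k \<and> u k \<le> 1" if "k < n" for k using that beta le_b b by (simp add: u_def)
  have tr: "mat_trace Finv = b * x"
    unfolding Finv_eq mat_trace_spectral_mat[OF U] x_def u_def using b by (simp add: sum_divide_distrib[symmetric])
  have op: "op_norm Finv = b"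
    unfolding Finv_eq b_def using n beta by (intro op_norm_spectral_mat U) (auto intro: less_imp_le)
  have sq: "Finv * Finv = spectral_mat n U (\<lambda>k. beta k * beta k)"
    unfolding Finv_eq by (rule spectral_mat_mult[OF U])
  have op2: "op_norm (Finv * Finv) = b\<^sup>2"
  proof -
    have "op_norm (Finv * Finv) = Max ((\<lambda>k. beta k * beta k) ` {..<n})"
      unfolding sq using n by (intro op_norm_spectral_mat U) auto
    also have "\<dots> = b * b"
    proof (rule Max_eqI)
      show "b * b \<in> (\<lambda>k. beta k * beta k) ` {..<n}" using k0 by auto
      fix y assume "y \<in> (\<lambda>k. beta k * beta k) ` {..<n}"
      then obtain k where "k < n" "y = beta k * beta k" by auto
      then show "y \<le> b * b" using le_b[of k] beta[of k] by (simp add: mult_mono)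
    qed simp
    finally show ?thesis by (simp add: power2_eq_square)
  qed
  have x_eq: "x = M * \<mu>" using balance b unfolding tr op by simp
  show x_ge: "1 \<le> M * \<mu>"
  proof -
    have "1 = u k0" using k0 b by (simp add: u_def)
    also have "\<dots> \<le> x" unfolding x_def by (rule member_le_sum) (use k0 u in \<open>auto intro: less_imp_le\<close>)
    finally show ?thesis by (simp add: x_eq)
  qed
  have uC: "(\<Sum>k<n. u k) \<le> C * (\<Sum>k<n. (u k)\<^sup>2)"
  proof -
    have "mat_trace (Finv * Finv) / op_norm (Finv * Finv) = (\<Sum>k<n. (u k)\<^sup>2)"
      unfolding op2 unfolding sq mat_trace_spectral_mat[OF U]
      by (simp add: u_def power_divide power2_eq_square sum_divide_distrib)
    then have "x \<le> C0 * (\<Sum>k<n. (u k)\<^sup>2)" using trace b unfolding tr op by simp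
    also have "\<dots> \<le> C * (\<Sum>k<n. (u k)\<^sup>2)" by (intro mult_right_mono C(2) sum_nonneg) simp
    finally show ?thesis by (simp add: x_def)
  qed
  \<comment> \<open>The prior standard deviations in the eigenbasis; \<open>1/8\<close> is small enough to give the Chernoff exponent
    \<open>3/2\<close>, and a rate above \<open>ln 2\<close> is what absorbs the final factor \<open>2\<close>.\<close>
  define s where "s k = u k * sqrt (b / 8)" for k
  define R where "R j k = r U j k * s k" for j k
  have s_sq: "(s k)\<^sup>2 / beta k = u k / 8" if "k < n" for k
    using b beta[OF that] by (simp add: s_def power_mult_distrib u_def power2_eq_square field_simps)
  have R_gram: "(\<Sum>j<m + n. R j i * R j k) = (if i = k then u i / 8 else 0)" if "i < n" "k < n" for i k
  proof -
    have "(\<Sum>j<m + n. R j i * R j k) = (\<Sum>j<m + n. r U j i * r U j k) * (s i * s k)"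
      unfolding R_def sum_distrib_right by (intro sum.cong refl) (simp only: mult_ac)
    also have "\<dots> = (if i = k then u i / 8 else 0)"
      using that s_sq[of i] by (auto simp: gram power2_eq_square)
    finally show ?thesis .
  qed
  let ?J = "{..<m + n}"
  let ?SJ = "\<Pi>\<^sub>M j\<in>?J. std_normal_distribution" and ?Sn = "\<Pi>\<^sub>M i\<in>{..<n}. std_normal_distribution"
  interpret SJ: prob_space ?SJ
    by (rule prob_space_PiM) (rule real_distribution.axioms(1)[OF real_dist_normal_dist])
  interpret Sn: prob_space ?Sn
    by (rule prob_space_PiM) (rule real_distribution.axioms(1)[OF real_dist_normal_dist])
  define f where "f z = U *\<^sub>v Matrix.vec n (\<lambda>k. s k * z k)" for z
  \<comment> \<open>The estimator in eigenbasis coordinates, as a function of the rescaled augmented observation, of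
    which it reads the first \<open>m\<close> entries.\<close>
  define a where "a k w = (\<Sum>i<n. U $$ (i, k) * vec_index (fhat (Matrix.vec m (\<lambda>j. \<sigma> * w j))) i)" for k and w :: "nat \<Rightarrow> real"
  define rad where "rad = 2 / (9 * (exp (5 * C) - 1)) * (b * x)"
  have fhat_carrier: "fhat y \<in> carrier_vec n" if "y \<in> carrier_vec m" for y
    using measurable_space[OF fhat[unfolded estimators_def]] that by simp
  have f_carrier: "f z \<in> carrier_vec n" for z using Uc by (auto simp: f_def)
  have f_index: "vec_index (f z) i = (\<Sum>k<n. U $$ (i, k) * (s k * z k))" if "i < n" for z i
    using that Uc by (simp add: f_def scalar_prod_def lessThan_atLeast0)
  have mult_f: "vec_index (B *\<^sub>v f z) j = (\<Sum>k<n. (B * U) $$ (j, k) * (s k * z k))"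
    if B: "B \<in> carrier_mat l n" "j < l" for B l z j
  proof -
    have "B *\<^sub>v f z = (B * U) *\<^sub>v Matrix.vec n (\<lambda>k. s k * z k)"
      unfolding f_def by (rule assoc_mult_mat_vec[symmetric, OF B(1) Uc]) simp
    moreover have "vec_index (W *\<^sub>v Matrix.vec n c) j = (\<Sum>k<n. W $$ (j, k) * c k)"
      if "W \<in> carrier_mat l n" for W and c :: "nat \<Rightarrow> real"
      using that B(2) by (simp add: scalar_prod_def lessThan_atLeast0)
    ultimately show ?thesis using mult_carrier_mat[OF B(1) Uc] by (simp only:)
  qed
  have a_m: "a k \<in> borel_measurable (\<Pi>\<^sub>M j\<in>?J. (borel :: real measure))" for k
  proof -
    have "(\<lambda>w. Matrix.vec m (\<lambda>j. \<sigma> * w j)) \<in> measurable (\<Pi>\<^sub>M j\<in>?J. (borel :: real measure)) (vec_borel m)"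
    proof (rule measurable_vec_borelI)
      fix i assume i: "i < m"
      have "(\<lambda>w. \<sigma> * w i) \<in> borel_measurable (\<Pi>\<^sub>M j\<in>?J. (borel :: real measure))"
        using i by (intro borel_measurable_times borel_measurable_const measurable_component_singleton) simp
      then show "(\<lambda>w. vec_index (Matrix.vec m (\<lambda>j. \<sigma> * w j)) i) \<in> borel_measurable (\<Pi>\<^sub>M j\<in>?J. (borel :: real measure))"
        using i by simp
    qed simp
    from measurable_compose[OF this fhat[unfolded estimators_def]]
    have "(\<lambda>w. vec_index (fhat (Matrix.vec m (\<lambda>j. \<sigma> * w j))) i) \<in> borel_measurable (\<Pi>\<^sub>M j\<in>?J. (borel :: real measure))"
      if "i < n" for i
      using measurable_compose[OF _ measurable_vec_index[OF that]] by blast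
    then show ?thesis unfolding a_def by (intro borel_measurable_sum borel_measurable_times) auto
  qed
  have loss: "(vec_norm2 (fhat (Matrix.vec m (\<lambda>j. vec_index (A *\<^sub>v f z) j + \<sigma> * e j)) - f z))\<^sup>2
      = (\<Sum>k<n. (a k (\<lambda>j\<in>?J. (\<Sum>k<n. R j k * z k) + e j) - u k * sqrt (b / 8) * z k)\<^sup>2)" for z e
  proof -
    let ?w = "\<lambda>j\<in>?J. (\<Sum>k<n. R j k * z k) + e j"
    let ?y = "Matrix.vec m (\<lambda>j. \<sigma> * ?w j)"
    have "Matrix.vec m (\<lambda>j. vec_index (A *\<^sub>v f z) j + \<sigma> * e j) = ?y"
    proof (rule eq_vecI)
      fix j assume "j < dim_vec ?y"
      then have j: "j < m" by simp
      have "vec_index (A *\<^sub>v f z) j = \<sigma> * (\<Sum>k<n. R j k * z k)"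
        unfolding mult_f[OF A j] sum_distrib_left
        using j sigma by (intro sum.cong refl) (simp add: R_def r_def del: index_mult_mat(1))
      then show "vec_index (Matrix.vec m (\<lambda>j. vec_index (A *\<^sub>v f z) j + \<sigma> * e j)) j = vec_index ?y j"
        using j by (simp add: ring_distribs)
    qed simp
    moreover have "(vec_norm2 (fhat ?y - f z))\<^sup>2 = (\<Sum>k<n. (a k ?w - s k * z k)\<^sup>2)"
    proof -
      have c: "fhat ?y \<in> carrier_vec n" by (rule fhat_carrier) simp
      have coord: "(\<Sum>i<n. U $$ (i, k) * vec_index (f z) i) = s k * z k" if k: "k < n" for k
      proof -
        have "(\<Sum>i<n. U $$ (i, k) * vec_index (f z) i) = (\<Sum>i<n. \<Sum>l<n. U $$ (i, k) * U $$ (i, l) * (s l * z l))"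
          by (simp add: f_index sum_distrib_left mult_ac)
        also have "\<dots> = (\<Sum>l<n. (\<Sum>i<n. U $$ (i, k) * U $$ (i, l)) * (s l * z l))"
          by (subst sum.swap) (simp add: sum_distrib_right)
        also have "\<dots> = (\<Sum>l<n. if l = k then s k * z k else 0)"
          by (intro sum.cong refl) (use k in \<open>auto simp: real_orthogonal_mat_cols[OF U]\<close>)
        finally show ?thesis using k by simp
      qed
      have "(vec_norm2 (fhat ?y - f z))\<^sup>2 = (\<Sum>i<n. (vec_index (fhat ?y) i - vec_index (f z) i)\<^sup>2)"
        using c f_carrier[of z] by (subst vec_norm2_square[of _ n]) auto
      also have "\<dots> = (\<Sum>k<n. (\<Sum>i<n. U $$ (i, k) * (vec_index (fhat ?y) i - vec_index (f z) i))\<^sup>2)"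
        by (rule real_orthogonal_mat_parseval[OF U, symmetric])
      also have "\<dots> = (\<Sum>k<n. (a k ?w - s k * z k)\<^sup>2)"
        by (intro sum.cong refl) (simp add: right_diff_distrib sum_subtractf coord a_def)
      finally show ?thesis .
    qed
    ultimately show ?thesis by (simp only: s_def)
  qed
  have in_ellipsoid: "f z \<in> ellipsoid G M" if z: "(\<Sum>k<n. u k * (z k)\<^sup>2) \<le> 8 * x" for z
  proof -
    have "\<mu> * (vec_norm2 (G *\<^sub>v f z))\<^sup>2 = (\<Sum>j<n. (\<Sum>k<n. R (m + j) k * z k)\<^sup>2)"
    proof -
      have "\<mu> * (vec_norm2 (G *\<^sub>v f z))\<^sup>2 = (\<Sum>j<n. \<mu> * (vec_index (G *\<^sub>v f z) j)\<^sup>2)"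
        using G f_carrier[of z] by (subst vec_norm2_square[of _ n]) (auto simp: sum_distrib_left)
      also have "\<dots> = (\<Sum>j<n. (\<Sum>k<n. R (m + j) k * z k)\<^sup>2)"
      proof (intro sum.cong refl)
        fix j assume "j \<in> {..<n}"
        then have "(\<Sum>k<n. R (m + j) k * z k) = sqrt \<mu> * vec_index (G *\<^sub>v f z) j"
          by (subst mult_f[OF G]) (auto simp: R_def r_def sum_distrib_left mult_ac simp del: index_mult_mat(1))
        then show "\<mu> * (vec_index (G *\<^sub>v f z) j)\<^sup>2 = (\<Sum>k<n. R (m + j) k * z k)\<^sup>2"
          using mu by (simp add: power_mult_distrib del: index_mult_mat_vec)
      qed
      finally show ?thesis .
    qed
    also have "\<dots> \<le> (\<Sum>j<m + n. (\<Sum>k<n. R j k * z k)\<^sup>2)"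
      unfolding sum_lessThan_add_split by (simp add: sum_nonneg)
    also have "\<dots> = (\<Sum>k<n. (\<Sum>j<m + n. (R j k)\<^sup>2) * (z k)\<^sup>2)"
      by (rule sum_square_orthogonal_columns) (simp add: R_gram)
    also have "\<dots> = (\<Sum>k<n. u k * (z k)\<^sup>2) / 8"
      unfolding sum_divide_distrib by (intro sum.cong refl) (simp add: power2_eq_square R_gram)
    also have "\<dots> \<le> \<mu> * M" using z by (simp add: x_eq mult.commute)
    finally show ?thesis using mu G f_carrier[of z] by (simp add: ellipsoid_def)
  qed
  let ?p = "\<lambda>f. \<P>(y in obs_law A \<sigma> f. (vec_norm2 (fhat y - f))\<^sup>2 > rad)"
  define S where "S = (SUP f\<in>ellipsoid G M. ?p f)"
  have p_le: "?p g \<le> S" if "g \<in> ellipsoid G M" for g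
    unfolding S_def
  proof (rule cSUP_upper[OF that])
    show "bdd_above (?p ` ellipsoid G M)"
      by (rule bdd_aboveI2[of _ _ 1]) (rule prob_space.prob_le_1[OF prob_space_obs_law])
  qed
  define T where "T z = {e \<in> space ?SJ. (\<Sum>k<n. (a k (\<lambda>j\<in>?J. (\<Sum>k<n. R j k * z k) + e j) - u k * sqrt (b / 8) * z k)\<^sup>2) \<le> rad}" for z
  have p_eq: "emeasure ?SJ (T z) = ennreal (1 - ?p (f z))" for z
  proof -
    let ?Y = "\<lambda>e. Matrix.vec m (\<lambda>j. vec_index (A *\<^sub>v f z) j + \<sigma> * e j)"
    let ?Q = "{y \<in> space (vec_borel m). (vec_norm2 (fhat y - f z))\<^sup>2 > rad}"
    have law: "obs_law A \<sigma> (f z) = distr ?SJ (vec_borel m) ?Y"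
      by (rule obs_law_eq_distr[OF A]) simp
    have Y_m: "?Y \<in> measurable ?SJ (vec_borel m)"
    proof (rule measurable_vec_borelI)
      fix i assume i: "i < m"
      have [measurable]: "(\<lambda>e. e i) \<in> borel_measurable ?SJ"
        using measurable_component_singleton[of i ?J "\<lambda>_. std_normal_distribution"] i by simp
      have "(\<lambda>e. vec_index (A *\<^sub>v f z) i + \<sigma> * e i) \<in> borel_measurable ?SJ"
        by measurable
      then show "(\<lambda>e. vec_index (?Y e) i) \<in> borel_measurable ?SJ" using i by simp
    qed simp
    have Q: "?Q \<in> sets (vec_borel m)"
    proof -
      have [measurable]: "(\<lambda>y. vec_index (fhat y) i) \<in> borel_measurable (vec_borel m)" if "i < n" for i
        using measurable_compose[OF fhat[unfolded estimators_def] measurable_vec_index[OF that]] .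
      have "?Q = {y \<in> space (vec_borel m). (\<Sum>i<n. (vec_index (fhat y) i - vec_index (f z) i)\<^sup>2) > rad}"
        using fhat_carrier f_carrier[of z] by (auto simp: vec_norm2_square[of _ n])
      also have "\<dots> \<in> sets (vec_borel m)" by measurable
      finally show ?thesis .
    qed
    have "?p (f z) = measure (distr ?SJ (vec_borel m) ?Y) ?Q"
      unfolding law by simp
    also have "\<dots> = measure ?SJ (?Y -` ?Q \<inter> space ?SJ)"
      by (rule measure_distr[OF Y_m Q])
    also have "?Y -` ?Q \<inter> space ?SJ = space ?SJ - T z"
      unfolding T_def loss[symmetric] by auto
    finally have p: "?p (f z) = measure ?SJ (space ?SJ - T z)" .
    have "T z = space ?SJ - ?Y -` ?Q \<inter> space ?SJ"
      unfolding T_def loss[symmetric] by auto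
    then have "T z \<in> sets ?SJ" using measurable_sets[OF Y_m Q] by auto
    then show ?thesis using p by (simp add: SJ.prob_compl SJ.emeasure_eq_measure)
  qed
  define eps where "eps = exp (- (3 / 2) * (M * \<mu>))"
  define bad where "bad = {z \<in> space ?Sn. 8 * (\<Sum>i<n. u i) < (\<Sum>i<n. u i * (z i)\<^sup>2)}"
  have bad_m: "bad \<in> sets ?Sn" unfolding bad_def by measurable
  have bad: "measure ?Sn bad \<le> eps"
  proof -
    have "emeasure ?Sn bad \<le> ennreal eps"
      unfolding bad_def eps_def x_eq[symmetric] x_def
      by (rule gaussian_weighted_chi_square_tail) (use u in \<open>auto intro: less_imp_le\<close>)
    then show ?thesis by (simp add: Sn.emeasure_eq_measure eps_def)
  qed
  have small: "(\<integral>\<^sup>+z. emeasure ?SJ (T z) \<partial>?Sn) \<le> ennreal eps"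
    unfolding T_def rad_def eps_def x_eq[symmetric] x_def
    by (rule gaussian_bayes_small_ball_probability)
      (use b u C uC a_m R_gram in \<open>auto simp: power2_eq_square\<close>)
  have "0 \<le> M * \<mu>" using M mu by simp
  then have zero_in: "f (\<lambda>_. 0) \<in> ellipsoid G M" by (intro in_ellipsoid) (simp add: x_eq)
  have S0: "0 \<le> S" using p_le[OF zero_in] measure_nonneg order_trans by blast
  have S1: "S \<le> 1"
    unfolding S_def using zero_in
    by (intro cSUP_least) (auto intro: prob_space.prob_le_1[OF prob_space_obs_law])
  have "ennreal ((1 - S) * (1 - measure ?Sn bad)) = ennreal (1 - S) * emeasure ?Sn (space ?Sn - bad)"
    using S1 by (simp add: Sn.emeasure_eq_measure Sn.prob_compl[OF bad_m] ennreal_mult)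
  also have "\<dots> = (\<integral>\<^sup>+z. ennreal (1 - S) * indicator (space ?Sn - bad) z \<partial>?Sn)"
    using bad_m by (simp add: nn_integral_cmult_indicator)
  also have "\<dots> \<le> (\<integral>\<^sup>+z. emeasure ?SJ (T z) \<partial>?Sn)"
  proof (rule nn_integral_mono)
    fix z assume z: "z \<in> space ?Sn"
    show "ennreal (1 - S) * indicator (space ?Sn - bad) z \<le> emeasure ?SJ (T z)"
    proof (cases "z \<in> bad")
      case False
      then have "f z \<in> ellipsoid G M" using z by (intro in_ellipsoid) (simp add: bad_def x_def not_less)
      from p_le[OF this] show ?thesis using z False by (simp add: p_eq ennreal_leI)
    qed simp
  qed
  also note small
  finally have "(1 - S) * (1 - measure ?Sn bad) \<le> eps" by (simp add: eps_def)
  moreover have "(1 - S) * (1 - eps) \<le> (1 - S) * (1 - measure ?Sn bad)"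
    using S1 bad by (intro mult_left_mono) auto
  moreover have "(1 - S) * (1 - eps) = 1 - S - eps + S * eps" by (simp add: algebra_simps)
  moreover have "0 \<le> S * eps" using S0 by (simp add: eps_def)
  ultimately have "1 - 2 * eps \<le> S" by linarith
  then show "1 - 2 * exp (- (3 / 2) * (M * \<mu>)) \<le> (SUP f\<in>ellipsoid G M.
      \<P>(y in obs_law A \<sigma> f. (vec_norm2 (fhat y - f))\<^sup>2 > 2 / (9 * (exp (5 * C) - 1)) * mat_trace Finv))"
    unfolding S_def eps_def rad_def tr .
qed

theorem theorem4p14:
  fixes C :: real
  shows "\<exists>C1>0. \<exists>C2>0.
    \<forall>(n::nat) (m::nat) (A::real mat) (\<sigma>::real) (G2::real mat) (G::real mat)
      (M::real) (\<mu>::real) (Finv::real mat).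
      1 \<le> n \<longrightarrow>
      A \<in> carrier_mat m n \<longrightarrow>
      0 < \<sigma> \<longrightarrow>
      sym_positive_mat n G2 \<longrightarrow>
      G \<in> carrier_mat n n \<longrightarrow> transpose_mat G = G \<longrightarrow> G * G = G2 \<longrightarrow>
      0 < M \<longrightarrow>
      1 \<le> \<mu> \<longrightarrow>
      Finv \<in> carrier_mat n n \<longrightarrow>
      inverts_mat (Fisher_pen A \<sigma> G2 \<mu>) Finv \<longrightarrow>
      inverts_mat Finv (Fisher_pen A \<sigma> G2 \<mu>) \<longrightarrow>
      M * \<mu> * op_norm Finv = mat_trace Finv \<longrightarrow>
      mat_trace ((1 / op_norm Finv) \<cdot>\<^sub>m Finv)
        \<le> C * mat_trace ((1 / op_norm (Finv ^\<^sub>m 2)) \<cdot>\<^sub>m (Finv ^\<^sub>m 2)) \<longrightarrow>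
      (INF fhat\<in>estimators m n. SUP f\<in>ellipsoid G M.
         \<P>(y in obs_law A \<sigma> f. (vec_norm2 (fhat y - f))\<^sup>2 > C1 * mat_trace Finv))
        \<ge> 1 - exp (- (C2 * M * \<mu>))"
proof -
  \<comment> \<open>The constants require \<open>C \<ge> 1\<close>; enlarging \<open>C\<close> weakens the trace condition.\<close>
  define C' where "C' = max C 1"
  define C1 where "C1 = 2 / (9 * (exp (5 * C') - 1))"
  have C': "1 \<le> C'" "C \<le> C'" by (auto simp: C'_def)
  have C1: "0 < C1" using C' by (simp add: C1_def)
  show ?thesis
  proof (rule exI[of _ C1], rule conjI[OF C1], rule exI[of _ "1 / 2"], rule conjI, simp, intro allI impI)
    fix n m :: nat and A :: "real mat" and \<sigma> :: real and G2 G :: "real mat" and M \<mu> :: real and Finv :: "real mat"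
    assume n: "1 \<le> n" and A: "A \<in> carrier_mat m n" and sigma: "0 < \<sigma>" and "sym_positive_mat n G2"
      and G: "G \<in> carrier_mat n n" and G_sym: "transpose_mat G = G" and GG: "G * G = G2"
      and M: "0 < M" and mu: "1 \<le> \<mu>" and Finv: "Finv \<in> carrier_mat n n"
      and inv: "inverts_mat (Fisher_pen A \<sigma> G2 \<mu>) Finv" "inverts_mat Finv (Fisher_pen A \<sigma> G2 \<mu>)"
      and balance: "M * \<mu> * op_norm Finv = mat_trace Finv"
      and trace: "mat_trace ((1 / op_norm Finv) \<cdot>\<^sub>m Finv)
        \<le> C * mat_trace ((1 / op_norm (Finv ^\<^sub>m 2)) \<cdot>\<^sub>m (Finv ^\<^sub>m 2))"
    have F: "Fisher_pen A \<sigma> (G * G) \<mu> \<in> carrier_mat n n"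
      using A G by (auto simp: Fisher_pen_def Fisher_def)
    have inv': "Fisher_pen A \<sigma> (G * G) \<mu> * Finv = 1\<^sub>m n" "Finv * Fisher_pen A \<sigma> (G * G) \<mu> = 1\<^sub>m n"
      using inv F Finv unfolding GG inverts_mat_def by auto
    have pow2: "Finv ^\<^sub>m 2 = Finv * Finv" using Finv by (simp add: numeral_2_eq_2)
    have FF: "Finv * Finv \<in> carrier_mat n n" using Finv by auto
    have trace': "mat_trace Finv / op_norm Finv \<le> C * (mat_trace (Finv * Finv) / op_norm (Finv * Finv))"
      using trace unfolding pow2 mat_trace_smult[OF Finv] mat_trace_smult[OF FF] by simp
    have bound: "1 \<le> M * \<mu> \<and> 1 - 2 * exp (- (3 / 2) * (M * \<mu>)) \<le> (SUP f\<in>ellipsoid G M.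
      \<P>(y in obs_law A \<sigma> f. (vec_norm2 (fhat y - f))\<^sup>2 > C1 * mat_trace Finv))"
      if fhat: "fhat \<in> estimators m n" for fhat
      unfolding C1_def using mu M
      by (intro conjI minimax_lower_bound_ellipsoid[OF n A sigma G G_sym _ _ Finv inv' balance C' trace' fhat]) auto
    have const: "(\<lambda>_. 0\<^sub>v n) \<in> estimators m n"
      unfolding estimators_def by (rule measurable_const) simp
    show "1 - exp (- (1 / 2 * M * \<mu>)) \<le> (INF fhat\<in>estimators m n. SUP f\<in>ellipsoid G M.
         \<P>(y in obs_law A \<sigma> f. (vec_norm2 (fhat y - f))\<^sup>2 > C1 * mat_trace Finv))"
    proof (rule cINF_greatest)
      show "estimators m n \<noteq> {}" using const by auto
      fix fhat assume fhat: "fhat \<in> estimators m n"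
      let ?x = "M * \<mu>"
      have "1 \<le> ?x" using bound[OF fhat] by simp
      then have "2 \<le> exp ?x" using exp_ge_add_one_self[of ?x] by linarith
      then have "2 * exp (- (3 / 2) * ?x) \<le> exp ?x * exp (- (3 / 2) * ?x)" by (intro mult_right_mono) auto
      also have "\<dots> = exp (- (1 / 2 * M * \<mu>))" by (simp flip: exp_add)
      finally show "1 - exp (- (1 / 2 * M * \<mu>)) \<le> (SUP f\<in>ellipsoid G M.
         \<P>(y in obs_law A \<sigma> f. (vec_norm2 (fhat y - f))\<^sup>2 > C1 * mat_trace Finv))"
        using bound[OF fhat] by linarith
    qed
  qed
qed

end
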